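(* Let $(\mathcal A,\mathcal C,E,\alpha^* )$ be a covariant positive flow with phase space $X$ and (finite) spectral potential $\lambda$. Let $L\subset C(X)$ be a vector subspace, $\varphi\in L$, let $\nu$ be a $\varphi$-sensitive state, and put $P_n=\nu(\,\cdot\,E_\varphi^n)/\nu(E_\varphi^n)$. (1) For any $u\in L^*$ and any number $t_1>\tau_\varphi^L(u)$ there exists a neighborhood $O(u)\subset L^*$ of $u$ in the *-weak topology such that for all sufficiently large $n$ $$P_n\bigl\{x\in X\bigm|\delta_{x,n}|_L\in O(u)\bigr\}<e^{nt_1}.$$ (2) If the state $\nu$ is simultaneously sensitive with respect to two functions $\varphi,\psi\in L$, then for any *-weakly open subset $U\subset L^*$ containing $M_\psi^L$ and any number $t_2<\inf\{\tau_\varphi^L(u)\mid u\in M_\psi^L\}$, $$P_n\bigl\{x\in X\bigm|\delta_{x,n}|_L\in U\bigr\}>e^{nt_2}$$ for all sufficiently large $n$.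
   Context: All algebras are real and associative. A cone in a real vector space is a convex subset $K$ with $tK\subset K$ for $t\ge0$ and such that $v,-v\in K$ imply $v=0$; $u\le v$ means $v-u\in K$. A positive algebra is a real normed algebra $\mathcal A$ ($\|ab\|\le\|a\|\|b\|$) with unit $I$, $\|I\|=1$, and a cone $\mathcal A_+$ closed under products and containing $I$, whose norm is monotone: $\|u\|\le\|u+v\|$ for $u,v\in\mathcal A_+$. A phase subalgebra $\mathcal C\subset\mathcal A$ is a commutative subalgebra containing $I$ such that each $a\in\mathcal C$ satisfies $-tI\le a\le tI$ for some $t>0$. If $\mathcal A_+$ is closed, there is a Hausdorff compact set $X$, unique up to homeomorphism (the phase space), such that $\mathcal C$ is isomorphic, including the order, to a dense subalgebra of $C(X)$ (real continuous functions, supremum norm); $\mathcal C$ is identified with this subalgebra. When $\mathcal A$ is moreover complete, the inclusion $\mathcal C\to\mathcal A$ extends uniquely to a continuous, injective, positive homomorphism $C(X)\to\mathcal A$, by which $C(X)$ is regarded as a subalgebra of $\mathcal A$. A covariant positive flow $(\mathcal A,\mathcal C,E,\alpha^* )$ consists of a positive algebra $\mathcal A$, complete in norm, with closed cone $\mathcal A_+$; a phase subalgebra $\mathcal C$ with phase space $X$; an element $E\in\mathcal A_+$; and a positive unital homomorphism $\alpha^*:\mathcal C\to\mathcal C$ with $Ef=\alpha^*(f)E$ for all $f\in\mathcal C$. There is a unique continuous $\alpha:X\to X$ with $\alpha^*(f)=f\circ\alpha$. For $\varphi\in C(X)$ put $E_\varphi=e^\varphi E$. The spectral potential is $\lambda(\varphi)=\lim_{n\to\infty}\frac1n\ln\|E_\varphi^n\|$;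 standing assumption: $\lambda$ is finite on $C(X)$ (otherwise $\lambda\equiv-\infty$). The functional $\lambda$ is convex and continuous. A state is a positive continuous linear functional $\nu$ on $\mathcal A$; it is $\varphi$-sensitive (sensitive with respect to $\varphi$) if $\lim_{n\to\infty}\frac1n\ln\nu(E_\varphi^n)=\lambda(\varphi)$. $P_n$ is the Borel probability measure on $X$ given (Riesz theorem) by $P_n(g)=\nu(gE_\varphi^n)/\nu(E_\varphi^n)$, $g\in C(X)$, defined for all sufficiently large $n$. Empirical measures: $\delta_{x,n}(f)=\frac1n\sum_{i=0}^{n-1}f(\alpha^i(x))$, $f\in C(X)$. For $\mu\in C^*(X)$: the dual entropy is $S(\mu)=\inf_{\psi\in C(X)}(\lambda(\psi)-\mu(\psi))\in[-\infty,\infty)$ and the action functional is $\tau_\varphi(\mu)=\mu(\varphi)+S(\mu)-\lambda(\varphi)$. $L$ carries the supremum norm and $L^*$ is its continuous dual; the conditional action functional is $\tau_\varphi^L(u)=\sup\{\tau_\varphi(\mu)\mid\mu\in C^*(X),\ \mu|_L=u\}$, $u\in L^*$. $M_\psi^L\subset L^*$ is the set of all subgradients of the restriction $\lambda|_L$ at $\psi\in L$, i.e. of $u\in L^*$ with $\lambda(\psi+\chi)-\lambda(\psi)\ge u(\chi)$ for all $\chi\in L$. *)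

theory Defs
  imports "HOL-Analysis.Analysis"
begin

section \<open>Positive algebras and covariant positive flows\<close>

text \<open>
  The type class already supplies an associative unital real algebra with a submultiplicative norm
  and \<open>norm 1 = 1\<close>; the order of the algebra is given by the cone \<open>K\<close>.
\<close>

definition cone_le :: "'a::real_vector set \<Rightarrow> 'a \<Rightarrow> 'a \<Rightarrow> bool" where
  "cone_le K u v \<longleftrightarrow> v - u \<in> K"

locale positive_algebra =
  fixes K :: "'a::real_normed_algebra_1 set"
  assumes convex_K: "convex K"
    and cone_K: "cone K"
    and pointed_K: "\<And>v. v \<in> K \<Longrightarrow> - v \<in> K \<Longrightarrow> v = 0"
    and mult_K: "\<And>u v. u \<in> K \<Longrightarrow> v \<in> K \<Longrightarrow> u * v \<in> K"
    and one_K: "1 \<in> K"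
    and norm_mono_K: "\<And>u v. u \<in> K \<Longrightarrow> v \<in> K \<Longrightarrow> norm u \<le> norm (u + v)"

locale phase_subalgebra = positive_algebra K
  for K :: "'a::real_normed_algebra_1 set" +
  fixes C :: "'a set"
  assumes subspace_C: "subspace C"
    and mult_C: "\<And>a b. a \<in> C \<Longrightarrow> b \<in> C \<Longrightarrow> a * b \<in> C"
    and comm_C: "\<And>a b. a \<in> C \<Longrightarrow> b \<in> C \<Longrightarrow> a * b = b * a"
    and one_C: "1 \<in> C"
    and order_unit_C: "\<And>a. a \<in> C \<Longrightarrow>
      \<exists>t>0. cone_le K (- (t *\<^sub>R 1)) a \<and> cone_le K a (t *\<^sub>R 1)"

text \<open>Completeness of the algebra is the class \<open>banach\<close>. Only the values of \<open>astar\<close> on \<open>C\<close> matter.\<close>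

locale covariant_positive_flow = phase_subalgebra K C
  for K :: "'a::{real_normed_algebra_1,banach} set" and C :: "'a set" +
  fixes E :: 'a and astar :: "'a \<Rightarrow> 'a"
  assumes closed_K: "closed K"
    and E_K: "E \<in> K"
    and astar_C: "\<And>f. f \<in> C \<Longrightarrow> astar f \<in> C"
    and astar_add: "\<And>f g. f \<in> C \<Longrightarrow> g \<in> C \<Longrightarrow> astar (f + g) = astar f + astar g"
    and astar_scaleR: "\<And>c f. f \<in> C \<Longrightarrow> astar (c *\<^sub>R f) = c *\<^sub>R astar f"
    and astar_mult: "\<And>f g. f \<in> C \<Longrightarrow> g \<in> C \<Longrightarrow> astar (f * g) = astar f * astar g"
    and astar_one: "astar 1 = 1"
    and astar_pos: "\<And>f. f \<in> C \<Longrightarrow> f \<in> K \<Longrightarrow> astar f \<in> K"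
    and covariance: "\<And>f. f \<in> C \<Longrightarrow> E * f = astar f * E"

section \<open>The phase space\<close>

text \<open>
  The phase space is a type \<open>'x\<close> of class \<open>t2_space\<close> with \<open>compact UNIV\<close>, so that \<open>'x \<Rightarrow>\<^sub>C real\<close>
  is the space \<open>C(X)\<close> of all continuous real functions with the supremum norm. The library
  provides no product on this type.
\<close>

definition cfun_mult :: "('x::topological_space \<Rightarrow>\<^sub>C real) \<Rightarrow> ('x \<Rightarrow>\<^sub>C real) \<Rightarrow> ('x \<Rightarrow>\<^sub>C real)" where
  "cfun_mult f g = Bcontfun (\<lambda>x. apply_bcontfun f x * apply_bcontfun g x)"

definition cfun_exp :: "('x::topological_space \<Rightarrow>\<^sub>C real) \<Rightarrow> ('x \<Rightarrow>\<^sub>C real)" where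
  "cfun_exp f = Bcontfun (\<lambda>x. exp (apply_bcontfun f x))"

definition cfun_nonneg :: "('x::topological_space \<Rightarrow>\<^sub>C real) \<Rightarrow> bool" where
  "cfun_nonneg f \<longleftrightarrow> (\<forall>x. 0 \<le> apply_bcontfun f x)"

text \<open>The functions below have no junk values: both arguments of \<open>Bcontfun\<close> are in \<open>bcontfun\<close>.\<close>

lemma cfun_mult_apply [simp]:
  "apply_bcontfun (cfun_mult f g) x = apply_bcontfun f x * apply_bcontfun g x"
proof -
  obtain A B where "\<And>x. \<bar>apply_bcontfun f x\<bar> \<le> A" "\<And>x. \<bar>apply_bcontfun g x\<bar> \<le> B"
    using bounded_apply_bcontfun[of f] bounded_apply_bcontfun[of g] by (auto simp: bounded_iff)
  then have "\<And>x. \<bar>apply_bcontfun f x * apply_bcontfun g x\<bar> \<le> A * B"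
    unfolding abs_mult by (meson abs_ge_zero mult_mono order_trans)
  then have "bounded (range (\<lambda>x. apply_bcontfun f x * apply_bcontfun g x))"
    by (auto simp: bounded_iff)
  then have "(\<lambda>x. apply_bcontfun f x * apply_bcontfun g x) \<in> bcontfun"
    by (auto simp: bcontfun_def intro!: continuous_intros)
  then show ?thesis
    by (simp add: cfun_mult_def Bcontfun_inverse)
qed

lemma cfun_exp_apply [simp]:
  "apply_bcontfun (cfun_exp f) x = exp (apply_bcontfun f x)"
proof -
  obtain B where "\<And>x. \<bar>apply_bcontfun f x\<bar> \<le> B"
    using bounded_apply_bcontfun[of f] by (auto simp: bounded_iff)
  then have "\<And>x. norm (exp (apply_bcontfun f x)) \<le> exp B"
    by (simp add: abs_le_iff)
  then have "bounded (range (\<lambda>x. exp (apply_bcontfun f x)))"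
    by (auto simp: bounded_iff)
  then have "(\<lambda>x. exp (apply_bcontfun f x)) \<in> bcontfun"
    by (auto simp: bcontfun_def intro!: continuous_intros)
  then show ?thesis
    by (simp add: cfun_exp_def Bcontfun_inverse)
qed

text \<open>\<open>j\<close> is the isomorphism, including the order, of \<open>C\<close> onto a dense subalgebra of \<open>C(X)\<close>.\<close>

definition phase_space ::
  "'a::real_normed_algebra_1 set \<Rightarrow> 'a set \<Rightarrow> ('a \<Rightarrow> ('x::t2_space \<Rightarrow>\<^sub>C real)) \<Rightarrow> bool" where
  "phase_space K C j \<longleftrightarrow>
     compact (UNIV :: 'x set) \<and>
     (\<forall>a\<in>C. \<forall>b\<in>C. j (a + b) = j a + j b) \<and>
     (\<forall>c. \<forall>a\<in>C. j (c *\<^sub>R a) = c *\<^sub>R j a) \<and>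
     (\<forall>a\<in>C. \<forall>b\<in>C. j (a * b) = cfun_mult (j a) (j b)) \<and>
     j 1 = const_bcontfun 1 \<and>
     inj_on j C \<and>
     (\<forall>a\<in>C. a \<in> K \<longleftrightarrow> cfun_nonneg (j a)) \<and>
     closure (j ` C) = UNIV"

text \<open>
  \<open>J\<close> is the extension to \<open>C(X)\<close> of the inclusion of \<open>C\<close>. It is uniquely determined by these
  conditions, since \<open>j ` C\<close> is dense and \<open>J\<close> is continuous.
\<close>

definition phase_embedding ::
  "'a::real_normed_algebra_1 set \<Rightarrow> 'a set \<Rightarrow> ('a \<Rightarrow> ('x::t2_space \<Rightarrow>\<^sub>C real))
    \<Rightarrow> (('x \<Rightarrow>\<^sub>C real) \<Rightarrow> 'a) \<Rightarrow> bool" where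
  "phase_embedding K C j J \<longleftrightarrow>
     (\<forall>a\<in>C. J (j a) = a) \<and>
     bounded_linear J \<and>
     (\<forall>f g. J (cfun_mult f g) = J f * J g) \<and>
     inj J \<and>
     (\<forall>f. cfun_nonneg f \<longrightarrow> J f \<in> K)"

text \<open>\<open>alpha\<close> is the (unique) continuous map with \<open>astar f = f \<circ> alpha\<close>.\<close>

definition phase_map ::
  "'a::real_normed_algebra_1 set \<Rightarrow> ('a \<Rightarrow> 'a) \<Rightarrow> ('a \<Rightarrow> ('x::t2_space \<Rightarrow>\<^sub>C real))
    \<Rightarrow> ('x \<Rightarrow> 'x) \<Rightarrow> bool" where
  "phase_map C astar j alpha \<longleftrightarrow>
     continuous_on UNIV alpha \<and>
     (\<forall>f\<in>C. apply_bcontfun (j (astar f)) = apply_bcontfun (j f) \<circ> alpha)"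

section \<open>Spectral potential, states, empirical measures\<close>

text \<open>Logarithm of a nonnegative real; the library has \<open>ln 0 = 0\<close> instead.\<close>

definition ext_ln :: "real \<Rightarrow> ereal" where
  "ext_ln r = (if r = 0 then -\<infinity> else ereal (ln r))"

definition weighted ::
  "(('x::topological_space \<Rightarrow>\<^sub>C real) \<Rightarrow> 'a::real_normed_algebra_1) \<Rightarrow> 'a \<Rightarrow> ('x \<Rightarrow>\<^sub>C real) \<Rightarrow> 'a" where
  "weighted J E \<phi> = J (cfun_exp \<phi>) * E"

definition spectral_potential ::
  "(('x::topological_space \<Rightarrow>\<^sub>C real) \<Rightarrow> 'a::real_normed_algebra_1) \<Rightarrow> 'a \<Rightarrow> ('x \<Rightarrow>\<^sub>C real) \<Rightarrow> ereal" where
  "spectral_potential J E \<phi> =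
     lim (\<lambda>n. ereal (1 / real n) * ext_ln (norm (weighted J E \<phi> ^ n)))"

definition state :: "'a::real_normed_algebra_1 set \<Rightarrow> ('a \<Rightarrow>\<^sub>L real) \<Rightarrow> bool" where
  "state K \<nu> \<longleftrightarrow> (\<forall>a\<in>K. 0 \<le> blinfun_apply \<nu> a)"

definition sensitive ::
  "(('x::topological_space \<Rightarrow>\<^sub>C real) \<Rightarrow> 'a::real_normed_algebra_1) \<Rightarrow> 'a \<Rightarrow> ('a \<Rightarrow>\<^sub>L real)
    \<Rightarrow> ('x \<Rightarrow>\<^sub>C real) \<Rightarrow> bool" where
  "sensitive J E \<nu> \<phi> \<longleftrightarrow>
     (\<lambda>n. ereal (1 / real n) * ext_ln (blinfun_apply \<nu> (weighted J E \<phi> ^ n)))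
       \<longlonglongrightarrow> spectral_potential J E \<phi>"

text \<open>
  \<open>M\<close> is the measure assigned by the Riesz theorem to the functional \<open>F\<close>. Outer regularity makes
  \<open>M\<close> unique when the compact space is not metrizable.
\<close>

definition riesz_probability ::
  "(('x::t2_space \<Rightarrow>\<^sub>C real) \<Rightarrow> real) \<Rightarrow> 'x measure \<Rightarrow> bool" where
  "riesz_probability F M \<longleftrightarrow>
     sets M = sets borel \<and>
     emeasure M (space M) = 1 \<and>
     (\<forall>A\<in>sets borel. emeasure M A = (INF U\<in>{U. open U \<and> A \<subseteq> U}. emeasure M U)) \<and>
     (\<forall>g. integral\<^sup>L M (apply_bcontfun g) = F g)"

definition weighted_functional ::
  "(('x::topological_space \<Rightarrow>\<^sub>C real) \<Rightarrow> 'a::real_normed_algebra_1) \<Rightarrow> 'a \<Rightarrow> ('a \<Rightarrow>\<^sub>L real)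
    \<Rightarrow> ('x \<Rightarrow>\<^sub>C real) \<Rightarrow> nat \<Rightarrow> ('x \<Rightarrow>\<^sub>C real) \<Rightarrow> real" where
  "weighted_functional J E \<nu> \<phi> n g =
     blinfun_apply \<nu> (J g * weighted J E \<phi> ^ n) / blinfun_apply \<nu> (weighted J E \<phi> ^ n)"

definition empirical :: "('x::topological_space \<Rightarrow> 'x) \<Rightarrow> 'x \<Rightarrow> nat \<Rightarrow> ('x \<Rightarrow>\<^sub>C real) \<Rightarrow> real" where
  "empirical alpha x n f = 1 / real n * (\<Sum>i<n. apply_bcontfun f ((alpha ^^ i) x))"

section \<open>Dual of a subspace, entropy and action\<close>

text \<open>
  Functionals on \<open>L\<close> are represented by functions that are \<open>undefined\<close> outside \<open>L\<close>, so that
  distinct functions are distinct functionals; \<open>restrict f L\<close> is the restriction of \<open>f\<close> to \<open>L\<close>.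
\<close>

definition dual_on :: "'v::real_normed_vector set \<Rightarrow> ('v \<Rightarrow> real) set" where
  "dual_on L = {u \<in> extensional L.
     (\<forall>f\<in>L. \<forall>g\<in>L. u (f + g) = u f + u g) \<and>
     (\<forall>c. \<forall>f\<in>L. u (c *\<^sub>R f) = c * u f) \<and>
     continuous_on L u}"

text \<open>Topology of pointwise convergence on \<open>L\<close>.\<close>

definition weak_star_on :: "'v::real_normed_vector set \<Rightarrow> ('v \<Rightarrow> real) topology" where
  "weak_star_on L = subtopology (product_topology (\<lambda>_. euclideanreal) L) (dual_on L)"

definition dual_entropy ::
  "(('x::topological_space \<Rightarrow>\<^sub>C real) \<Rightarrow> 'a::real_normed_algebra_1) \<Rightarrow> 'a
    \<Rightarrow> (('x \<Rightarrow>\<^sub>C real) \<Rightarrow>\<^sub>L real) \<Rightarrow> ereal" where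
  "dual_entropy J E \<mu> = (INF \<psi>. spectral_potential J E \<psi> - ereal (blinfun_apply \<mu> \<psi>))"

definition action ::
  "(('x::topological_space \<Rightarrow>\<^sub>C real) \<Rightarrow> 'a::real_normed_algebra_1) \<Rightarrow> 'a
    \<Rightarrow> ('x \<Rightarrow>\<^sub>C real) \<Rightarrow> (('x \<Rightarrow>\<^sub>C real) \<Rightarrow>\<^sub>L real) \<Rightarrow> ereal" where
  "action J E \<phi> \<mu> =
     ereal (blinfun_apply \<mu> \<phi>) + dual_entropy J E \<mu> - spectral_potential J E \<phi>"

definition conditional_action ::
  "(('x::topological_space \<Rightarrow>\<^sub>C real) \<Rightarrow> 'a::real_normed_algebra_1) \<Rightarrow> 'a
    \<Rightarrow> ('x \<Rightarrow>\<^sub>C real) set \<Rightarrow> ('x \<Rightarrow>\<^sub>C real) \<Rightarrow> (('x \<Rightarrow>\<^sub>C real) \<Rightarrow> real) \<Rightarrow> ereal" where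
  "conditional_action J E L \<phi> u =
     (SUP \<mu>\<in>{\<mu>. restrict (blinfun_apply \<mu>) L = u}. action J E \<phi> \<mu>)"

definition subgradients_on ::
  "(('x::topological_space \<Rightarrow>\<^sub>C real) \<Rightarrow> 'a::real_normed_algebra_1) \<Rightarrow> 'a
    \<Rightarrow> ('x \<Rightarrow>\<^sub>C real) set \<Rightarrow> ('x \<Rightarrow>\<^sub>C real) \<Rightarrow> (('x \<Rightarrow>\<^sub>C real) \<Rightarrow> real) set" where
  "subgradients_on J E L \<psi> = {u \<in> dual_on L. \<forall>\<eta>\<in>L.
     spectral_potential J E (\<psi> + \<eta>) - spectral_potential J E \<psi> \<ge> ereal (u \<eta>)}"

end

theory Submission
  imports Defs
begin

text \<open>
  Covariance gives the cocycle formula \<open>E\<^sub>\<phi>\<^sup>n = exp (S\<^sub>n \<phi>) E\<^sup>n\<close> with the Birkhoff sums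
  \<open>S\<^sub>n \<phi> = n \<delta>\<^bsub>x,n\<^esub>(\<phi>)\<close>, so the integral of \<open>exp (S\<^sub>n \<eta>)\<close> against \<open>P\<^sub>n\<close> is
  \<open>\<nu> (E\<^bsub>\<phi>+\<eta>\<^esub>\<^sup>n) / \<nu> (E\<^sub>\<phi>\<^sup>n)\<close>, of exponential order at most \<open>\<lambda>(\<phi> + \<eta>) - \<lambda>(\<phi>)\<close>. For (1), Hahn--Banach
  with the convex majorant \<open>\<lambda>\<close> identifies \<open>\<tau>\<^sub>\<phi>\<^sup>L(u)\<close> with the infimum of
  \<open>u(\<phi>) + \<lambda>(\<psi>) - u(\<psi>) - \<lambda>(\<phi>)\<close> over \<open>\<psi> \<in> L\<close>, and Markov's inequality for \<open>\<eta> = \<psi> - \<phi>\<close>, with a nearly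
  optimal \<open>\<psi>\<close>, gives the bound. For (2), the measure \<open>P\<^sub>n\<close> is tilted by the density proportional to \<open>exp (S\<^sub>n (\<psi> - \<phi>))\<close>.
  Under the tilted measure, by Markov's inequality and Banach--Alaoglu compactness, the empirical measures
  concentrate near \<open>M\<^sub>\<psi>\<^sup>L\<close>, where the density is controlled by \<open>\<tau>\<^sub>\<phi>\<^sup>L\<close>.
\<close>

section \<open>Subadditive sequences and the Hahn--Banach theorem\<close>

text \<open>Division of \<open>n\<close> by a fixed \<open>m\<close> with remainder bounds
  \<open>a n / n\<close> by \<open>a m / m\<close> plus a term of order \<open>1 / n\<close>. The
  limit is taken in \<open>ereal\<close> since the infimum may be minus infinity, and the infimum
  starts at \<open>1\<close> because \<open>a 0 / 0\<close> is the default value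
  \<open>0\<close>.\<close>

lemma fekete:
  fixes a :: "nat \<Rightarrow> real"
  assumes sub: "\<And>m n. a (m + n) \<le> a m + a n"
  shows "(\<lambda>n. ereal (a n / real n)) \<longlonglongrightarrow> (INF n\<in>{1..}. ereal (a n / real n))"
proof (rule order_tendstoI)
  fix y assume "y < (INF n\<in>{1..}. ereal (a n / real n))"
  then have "y < ereal (a n / real n)" if "n \<ge> 1" for n
    using that by (auto intro: less_le_trans INF_lower)
  then show "\<forall>\<^sub>F n in sequentially. y < ereal (a n / real n)"
    by (auto simp: eventually_at_top_linorder)
next
  fix y assume "(INF n\<in>{1..}. ereal (a n / real n)) < y"
  then obtain m where m: "m \<ge> 1" and my: "ereal (a m / real m) < y"
    by (auto simp: INF_less_iff)
  obtain c where c: "a m / real m < c" "ereal c < y"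
    using ereal_dense2[OF my] by auto
  have mult: "a (q * m) \<le> real q * a m + \<bar>a 0\<bar>" for q
  proof (induction q)
    case (Suc q)
    then show ?case using sub[of m "q * m"] by (simp add: algebra_simps)
  qed simp
  \<comment> \<open>The three terms pay for replacing \<open>n div m\<close> by
    \<open>n / m\<close>, for the case \<open>q = 0\<close> in \<open>mult\<close>, and for any
    remainder below \<open>m\<close>.\<close>
  define D where "D = \<bar>a m\<bar> + \<bar>a 0\<bar> + (\<Sum>r<m. \<bar>a r\<bar>)"
  have bnd: "a n / real n \<le> a m / real m + D / real n" if n: "n \<ge> 1" for n
  proof -
    let ?q = "n div m" and ?r = "n mod m"
    have nqr: "n = ?q * m + ?r" by simp
    have r: "?r < m" using m by simp
    have "\<bar>a ?r\<bar> \<le> (\<Sum>r<m. \<bar>a r\<bar>)"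
      using r by (intro member_le_sum) auto
    moreover have "a n \<le> a (?q * m) + a ?r"
      using sub[of "?q * m" ?r] nqr by simp
    ultimately have 1: "a n \<le> real ?q * a m + \<bar>a 0\<bar> + (\<Sum>r<m. \<bar>a r\<bar>)"
      using mult[of ?q] by linarith
    have "real n = real ?q * real m + real ?r"
      using nqr by (metis of_nat_add of_nat_mult)
    then have "real ?q * a m = real n * (a m / real m) - (real ?r / real m) * a m"
      using m by (simp add: field_simps)
    moreover have "\<bar>(real ?r / real m) * a m\<bar> \<le> 1 * \<bar>a m\<bar>"
      unfolding abs_mult using r m by (intro mult_right_mono) auto
    ultimately have "real ?q * a m \<le> real n * (a m / real m) + \<bar>a m\<bar>" by linarith
    then have "a n \<le> real n * (a m / real m) + D"
      using 1 by (simp add: D_def)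
    then show ?thesis using n by (simp add: field_simps)
  qed
  have "(\<lambda>n. a m / real m + D / real n) \<longlonglongrightarrow> a m / real m + 0"
    by (intro tendsto_intros lim_const_over_n)
  then have "\<forall>\<^sub>F n in sequentially. a m / real m + D / real n < c"
    using c(1) by (auto intro: order_tendstoD)
  then show "\<forall>\<^sub>F n in sequentially. ereal (a n / real n) < y"
    using eventually_ge_at_top[of 1]
  proof eventually_elim
    case (elim n)
    then show ?case using bnd[of n] c(2) by (meson less_trans le_less_trans less_ereal.simps(1))
  qed
qed

text \<open>Partial linear extensions are encoded by their graphs; a graph lying below \<open>p\<close> is
  automatically single-valued, since a nonzero linear function on a line is unbounded.\<close>

lemma hahn_banach_convex:
  fixes p :: "'v::real_vector \<Rightarrow> real"
  assumes cvx: "convex_on UNIV p" and L: "subspace L"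
    and add: "\<And>x y. x \<in> L \<Longrightarrow> y \<in> L \<Longrightarrow> u (x + y) = u x + u y"
    and scale: "\<And>c x. x \<in> L \<Longrightarrow> u (c *\<^sub>R x) = c * u x"
    and le: "\<And>x. x \<in> L \<Longrightarrow> u x \<le> p x"
  obtains U where "linear U" "\<And>x. x \<in> L \<Longrightarrow> U x = u x" "\<And>x. U x \<le> p x"
proof -
  define \<G> where "\<G> = {G :: ('v \<times> real) set. subspace G \<and> (\<lambda>x. (x, u x)) ` L \<subseteq> G \<and> (\<forall>(x, r)\<in>G. r \<le> p x)}"
  have "subspace ((\<lambda>x. (x, u x)) ` L)"
    unfolding subspace_def
  proof (intro conjI ballI allI)
    have "u 0 = 0" using scale[of 0 0] subspace_0[OF L] by simp
    then show "0 \<in> (\<lambda>x. (x, u x)) ` L"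
      using subspace_0[OF L] by (auto simp: zero_prod_def intro!: image_eqI[of _ _ 0])
  next
    fix v w assume "v \<in> (\<lambda>x. (x, u x)) ` L" "w \<in> (\<lambda>x. (x, u x)) ` L"
    then obtain x y where "x \<in> L" "y \<in> L" "v = (x, u x)" "w = (y, u y)" by auto
    then show "v + w \<in> (\<lambda>x. (x, u x)) ` L"
      using subspace_add[OF L] by (auto simp: add intro!: image_eqI[of _ _ "x + y"])
  next
    fix c v assume "v \<in> (\<lambda>x. (x, u x)) ` L"
    then obtain x where "x \<in> L" "v = (x, u x)" by auto
    then show "c *\<^sub>R v \<in> (\<lambda>x. (x, u x)) ` L"
      using subspace_scale[OF L] by (auto simp: scale intro!: image_eqI[of _ _ "c *\<^sub>R x"])
  qed
  then have "(\<lambda>x. (x, u x)) ` L \<in> \<G>" using le by (auto simp: \<G>_def)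
  then have "\<G> \<noteq> {}" by blast
  moreover have "\<Union>\<C> \<in> \<G>" if ne: "\<C> \<noteq> {}" and ch: "subset.chain \<G> \<C>" for \<C>
  proof -
    have sub: "\<C> \<subseteq> \<G>" using ch by (simp add: subset.chain_def)
    have "subspace (\<Union>\<C>)"
      unfolding subspace_def
    proof (intro conjI ballI allI)
      show "0 \<in> \<Union>\<C>" using ne sub by (auto simp: \<G>_def subspace_def)
    next
      fix v w assume "v \<in> \<Union>\<C>" "w \<in> \<Union>\<C>"
      then obtain G H where "G \<in> \<C>" "H \<in> \<C>" "v \<in> G" "w \<in> H" by blast
      moreover have "G \<subseteq> H \<or> H \<subseteq> G"
        using ch \<open>G \<in> \<C>\<close> \<open>H \<in> \<C>\<close> by (auto simp: subset_chain_def)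
      ultimately obtain M where "M \<in> \<C>" "v \<in> M" "w \<in> M" by blast
      then show "v + w \<in> \<Union>\<C>" using sub by (auto simp: \<G>_def intro: subspace_add)
    next
      fix c v assume "v \<in> \<Union>\<C>"
      then show "c *\<^sub>R v \<in> \<Union>\<C>" using sub by (auto simp: \<G>_def intro: subspace_scale)
    qed
    moreover have "(\<lambda>x. (x, u x)) ` L \<subseteq> \<Union>\<C>"
      using ne sub unfolding \<G>_def by blast
    moreover have "\<forall>(x, r)\<in>\<Union>\<C>. r \<le> p x"
      using sub unfolding \<G>_def by blast
    ultimately show ?thesis by (simp add: \<G>_def)
  qed
  ultimately obtain G where "G \<in> \<G>" and max: "\<And>H. H \<in> \<G> \<Longrightarrow> G \<subseteq> H \<Longrightarrow> H = G"
    using subset_Zorn_nonempty[of \<G>] by metis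
  then have G: "subspace G" and GL: "\<And>x. x \<in> L \<Longrightarrow> (x, u x) \<in> G"
    and Gp: "\<And>x r. (x, r) \<in> G \<Longrightarrow> r \<le> p x"
    by (auto simp: \<G>_def)
  have total: "\<exists>r. (z, r) \<in> G" for z
  proof -
    \<comment> \<open>The value \<open>r\<close> at \<open>z\<close> must satisfy
      \<open>s + t * r \<le> p (y + t *\<^sub>R z)\<close> for all real \<open>t\<close>. Negative
      \<open>t\<close>, written with its sign changed, gives the lower bounds \<open>lo\<close>;
      positive \<open>t\<close> gives upper bounds.\<close>
    define lo where "lo = (\<lambda>(y, s, t). (s - p (y - t *\<^sub>R z)) / t)"
    define I where "I = {(y, s, t) | y s t. (y, s) \<in> G \<and> 0 < (t::real)}"
    have key: "lo (y, s, t) \<le> (p (y' + t' *\<^sub>R z) - s') / t'"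
      if "(y, s) \<in> G" "0 < t" "(y', s') \<in> G" "0 < t'" for y s t y' s' t'
    proof -
      \<comment> \<open>With this weight the multiples of \<open>z\<close> cancel, so the convex
        combination lies over the domain of \<open>G\<close>, where \<open>Gp\<close> applies.
        Convexity does here what subadditivity does for sublinear majorants.\<close>
      define \<theta> where "\<theta> = t / (t + t')"
      have th: "0 \<le> \<theta>" "0 \<le> 1 - \<theta>" "(1 - \<theta>) = t' / (t + t')"
        using that by (auto simp: \<theta>_def field_simps)
      have "\<theta> * t' = (1 - \<theta>) * t" by (simp add: th(3)) (simp add: \<theta>_def)
      then have eq: "(1 - \<theta>) *\<^sub>R (y - t *\<^sub>R z) + \<theta> *\<^sub>R (y' + t' *\<^sub>R z) = (1 - \<theta>) *\<^sub>R y + \<theta> *\<^sub>R y'"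
        by (simp add: scaleR_right_diff_distrib scaleR_right_distrib)
      have "(1 - \<theta>) *\<^sub>R (y, s) + \<theta> *\<^sub>R (y', s') \<in> G"
        using that G by (intro subspace_add subspace_scale)
      then have "(1 - \<theta>) * s + \<theta> * s' \<le> p ((1 - \<theta>) *\<^sub>R y + \<theta> *\<^sub>R y')"
        by (auto intro: Gp)
      also have "\<dots> \<le> (1 - \<theta>) * p (y - t *\<^sub>R z) + \<theta> * p (y' + t' *\<^sub>R z)"
        unfolding eq[symmetric] using th by (intro convex_onD[OF cvx]) auto
      finally have "(1 - \<theta>) * (s - p (y - t *\<^sub>R z)) \<le> \<theta> * (p (y' + t' *\<^sub>R z) - s')"
        by (simp add: algebra_simps)
      then have "t' * (s - p (y - t *\<^sub>R z)) \<le> t * (p (y' + t' *\<^sub>R z) - s')"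
        unfolding th(3) using that by (simp add: \<theta>_def divide_simps split: if_splits)
      then show ?thesis
        using that by (simp add: lo_def field_simps)
    qed
    have G0: "(0, 0) \<in> G" using subspace_0[OF G] by (simp add: zero_prod_def)
    then have "(0, 0, 1) \<in> I" by (simp add: I_def)
    then have Ine: "lo ` I \<noteq> {}" by blast
    have "bdd_above (lo ` I)"
      unfolding bdd_above_def using key[OF _ _ G0, of _ _ _ 1] by (fastforce simp: I_def)
    define r where "r = Sup (lo ` I)"
    have lo_le: "lo (y, s, t) \<le> r" if "(y, s) \<in> G" "0 < t" for y s t
      unfolding r_def using that \<open>bdd_above (lo ` I)\<close> by (intro cSup_upper) (auto simp: I_def)
    have le_hi: "r \<le> (p (y + t *\<^sub>R z) - s) / t" if "(y, s) \<in> G" "0 < t" for y s t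
      unfolding r_def using that Ine key by (intro cSup_least) (auto simp: I_def)
    have below: "s + t * r \<le> p (y + t *\<^sub>R z)" if ys: "(y, s) \<in> G" for y s t
    proof -
      consider "t = 0" | "t > 0" | "t < 0" by linarith
      then show ?thesis
      proof cases
        case 1 then show ?thesis using Gp ys by simp
      next
        case 2 then show ?thesis using le_hi[OF ys 2] by (simp add: field_simps)
      next
        case 3 then show ?thesis using lo_le[OF ys, of "- t"] by (simp add: lo_def field_simps)
      qed
    qed
    define H where "H = {v + w |v w. v \<in> G \<and> w \<in> span {(z, r)}}"
    have "subspace H"
      unfolding H_def by (intro subspace_sums G subspace_span)
    moreover have GH: "G \<subseteq> H"
    proof
      fix v assume "v \<in> G"
      then have "v + 0 \<in> H" unfolding H_def using span_0 by blast
      then show "v \<in> H" by simp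
    qed
    moreover have "\<forall>(x, q)\<in>H. q \<le> p x"
      using below by (auto simp: H_def span_singleton)
    ultimately have "H \<in> \<G>" using GL by (auto simp: \<G>_def)
    then have "H = G" using max GH by blast
    moreover have "0 + (z, r) \<in> H"
      unfolding H_def using subspace_0[OF G] span_base[of "(z, r)" "{(z, r)}"] by blast
    ultimately show ?thesis by auto
  qed
  have single: "r = r'" if "(x, r) \<in> G" "(x, r') \<in> G" for x r r'
  proof (rule ccontr)
    assume ne: "r \<noteq> r'"
    have "(x, r) - (x, r') \<in> G" using that G by (intro subspace_diff)
    then have "((p 0 + 1) / (r - r')) *\<^sub>R (0, r - r') \<in> G" using G by (intro subspace_scale) auto
    then have "(0, p 0 + 1) \<in> G" using ne by simp
    then show False using Gp[of 0 "p 0 + 1"] by simp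
  qed
  define U where "U x = (SOME r. (x, r) \<in> G)" for x
  have UG: "(x, U x) \<in> G" for x
    unfolding U_def using total[of x] by (rule someI_ex)
  show ?thesis
  proof
    show "linear U"
    proof (rule linearI)
      show "U (x + y) = U x + U y" for x y
        using single[OF UG[of "x + y"]] subspace_add[OF G UG[of x] UG[of y]] by simp
      show "U (c *\<^sub>R x) = c *\<^sub>R U x" for c x
        using single[OF UG[of "c *\<^sub>R x"]] subspace_scale[OF G UG[of x], of c] by simp
    qed
    show "U x = u x" if "x \<in> L" for x using single[OF UG GL[OF that]] .
    show "U x \<le> p x" for x using Gp UG .
  qed
qed

section \<open>Birkhoff sums and the spectral potential\<close>

definition cfun_comp :: "('x::topological_space \<Rightarrow>\<^sub>C real) \<Rightarrow> ('x \<Rightarrow> 'x) \<Rightarrow> ('x \<Rightarrow>\<^sub>C real)" where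
  "cfun_comp f \<alpha> = Bcontfun (\<lambda>x. apply_bcontfun f (\<alpha> x))"

definition birkhoff :: "('x::topological_space \<Rightarrow> 'x) \<Rightarrow> nat \<Rightarrow> ('x \<Rightarrow>\<^sub>C real) \<Rightarrow> ('x \<Rightarrow>\<^sub>C real)" where
  "birkhoff \<alpha> n f = Bcontfun (\<lambda>x. \<Sum>i<n. apply_bcontfun f ((\<alpha> ^^ i) x))"

lemma cfun_comp_apply:
  assumes "continuous_on UNIV \<alpha>"
  shows "apply_bcontfun (cfun_comp f \<alpha>) x = apply_bcontfun f (\<alpha> x)"
proof -
  have "(\<lambda>x. apply_bcontfun f (\<alpha> x)) \<in> bcontfun"
  proof (rule bcontfun_normI)
    show "continuous_on UNIV (\<lambda>x. apply_bcontfun f (\<alpha> x))"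
      using assms by (intro continuous_on_compose2[OF _ assms, of UNIV]) auto
    show "norm (apply_bcontfun f (\<alpha> x)) \<le> norm f" for x
      by (rule norm_bounded)
  qed
  then show ?thesis by (simp add: cfun_comp_def Bcontfun_inverse)
qed

lemma birkhoff_apply:
  assumes "continuous_on UNIV \<alpha>"
  shows "apply_bcontfun (birkhoff \<alpha> n f) x = (\<Sum>i<n. apply_bcontfun f ((\<alpha> ^^ i) x))"
proof -
  have it: "continuous_on UNIV (\<alpha> ^^ i)" for i
    by (induction i) (use assms in \<open>auto simp: o_def intro!: continuous_on_compose2[OF assms]\<close>)
  have "(\<lambda>x. \<Sum>i<n. apply_bcontfun f ((\<alpha> ^^ i) x)) \<in> bcontfun"
  proof (rule bcontfun_normI)
    show "continuous_on UNIV (\<lambda>x. \<Sum>i<n. apply_bcontfun f ((\<alpha> ^^ i) x))"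
      by (intro continuous_on_sum continuous_on_compose2[OF _ it, of UNIV]) auto
    show "norm (\<Sum>i<n. apply_bcontfun f ((\<alpha> ^^ i) x)) \<le> (\<Sum>i<n. norm f)" for x
      by (intro sum_norm_le norm_bounded)
  qed
  then show ?thesis by (simp add: birkhoff_def Bcontfun_inverse)
qed

lemma empirical_eq_birkhoff:
  assumes "continuous_on UNIV \<alpha>"
  shows "empirical \<alpha> x n f = apply_bcontfun (birkhoff \<alpha> n f) x / real n"
  by (simp add: empirical_def birkhoff_apply[OF assms])

text \<open>The flow as seen from C(X): covariance is stated for every continuous function instead
  of the elements of the phase subalgebra, so exponentials and Birkhoff sums can be moved past
  \<open>E\<close> directly.\<close>

locale weighted_flow = positive_algebra K
  for K :: "'a::real_normed_algebra_1 set" +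
  fixes E :: 'a and J :: "('x::t2_space \<Rightarrow>\<^sub>C real) \<Rightarrow> 'a" and \<alpha> :: "'x \<Rightarrow> 'x"
  assumes E_in_K: "E \<in> K"
    and bounded_linear_J: "bounded_linear J"
    and J_mult: "J (cfun_mult f g) = J f * J g"
    and J_one: "J (const_bcontfun 1) = 1"
    and J_pos: "cfun_nonneg f \<Longrightarrow> J f \<in> K"
    and continuous_alpha: "continuous_on UNIV \<alpha>"
    and E_J: "E * J f = J (cfun_comp f \<alpha>) * E"
    and finite_potential: "\<bar>spectral_potential J E f\<bar> \<noteq> \<infinity>"
begin

abbreviation W :: "('x \<Rightarrow>\<^sub>C real) \<Rightarrow> 'a" where "W \<equiv> weighted J E"

abbreviation S :: "nat \<Rightarrow> ('x \<Rightarrow>\<^sub>C real) \<Rightarrow> ('x \<Rightarrow>\<^sub>C real)" where "S \<equiv> birkhoff \<alpha>"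

lemmas S_apply = birkhoff_apply[OF continuous_alpha]

lemma S_add: "S n (f + g) = S n f + S n g"
  by (rule bcontfun_eqI) (simp add: S_apply sum.distrib)

lemma S_diff: "S n (f - g) = S n f - S n g"
  by (rule bcontfun_eqI) (simp add: S_apply sum_subtractf)

lemma S_scaleR: "S n (c *\<^sub>R f) = c *\<^sub>R S n f"
  by (rule bcontfun_eqI) (simp add: S_apply sum_distrib_left)

lemmas linear_J = bounded_linear.linear[OF bounded_linear_J]

lemma power_E_in_K: "E ^ n \<in> K"
  by (induction n) (auto simp: one_K intro: mult_K E_in_K)

text \<open>Moving \<open>E\<close> to the right past \<open>J f\<close> composes \<open>f\<close>
  with \<alpha>. Peeling off the leftmost factor thus matches the recursion in which the Birkhoff
  sum of length \<open>n + 1\<close> is \<open>f\<close> plus the sum of length \<open>n\<close>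
  evaluated at the image under \<alpha>.\<close>

lemma power_W: "W f ^ n = J (cfun_exp (S n f)) * E ^ n"
proof (induction n)
  case 0
  have "cfun_exp (S 0 f) = const_bcontfun 1"
    by (rule bcontfun_eqI) (simp add: S_apply)
  then show ?case by (simp add: J_one)
next
  case (Suc n)
  have "W f ^ Suc n = J (cfun_exp f) * (E * J (cfun_exp (S n f))) * E ^ n"
    by (simp only: power_Suc Suc.IH) (simp add: weighted_def mult.assoc)
  also have "\<dots> = J (cfun_mult (cfun_exp f) (cfun_comp (cfun_exp (S n f)) \<alpha>)) * E ^ Suc n"
    by (simp add: E_J J_mult mult.assoc)
  also have "cfun_mult (cfun_exp f) (cfun_comp (cfun_exp (S n f)) \<alpha>) = cfun_exp (S (Suc n) f)"
    by (rule bcontfun_eqI)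
      (simp add: cfun_comp_apply[OF continuous_alpha] S_apply sum.lessThan_Suc_shift exp_add
        funpow_swap1 del: sum.lessThan_Suc)
  finally show ?case .
qed

lemma J_mult_in_K: "cfun_nonneg f \<Longrightarrow> J f * E ^ n \<in> K"
  by (intro mult_K J_pos power_E_in_K)

lemma power_W_in_K: "W f ^ n \<in> K"
  unfolding power_W by (rule J_mult_in_K) (simp add: cfun_nonneg_def)

text \<open>The difference of the two elements lies in the cone, on which the norm is monotone. This
  is how pointwise inequalities between Birkhoff sums become inequalities between norms of
  powers.\<close>

lemma norm_J_mult_mono:
  assumes "\<And>x. 0 \<le> apply_bcontfun f x" "\<And>x. apply_bcontfun f x \<le> apply_bcontfun g x"
  shows "norm (J f * E ^ n) \<le> norm (J g * E ^ n)"
proof -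
  have "norm (J f * E ^ n) \<le> norm (J f * E ^ n + J (g - f) * E ^ n)"
    by (intro norm_mono_K J_mult_in_K) (use assms in \<open>auto simp: cfun_nonneg_def\<close>)
  also have "J f * E ^ n + J (g - f) * E ^ n = J g * E ^ n"
    by (simp add: linear_diff[OF linear_J] ring_distribs)
  finally show ?thesis .
qed

section \<open>Growth rates, Lipschitz bound and convexity of the spectral potential\<close>

definition lam :: "('x \<Rightarrow>\<^sub>C real) \<Rightarrow> real" where
  "lam f = real_of_ereal (spectral_potential J E f)"

lemma spectral_potential_eq: "spectral_potential J E f = ereal (lam f)"
  using finite_potential[of f] by (simp add: lam_def ereal_real')

text \<open>One vanishing power makes all later ones vanish, and the potential would be minus
  infinity. Hence \<open>ln\<close> and \<open>ext_ln\<close> agree on the norms of powers.\<close>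

lemma power_W_nonzero: "W f ^ n \<noteq> 0"
proof
  assume n: "W f ^ n = 0"
  \<comment> \<open>For \<open>m = 0\<close> the factor \<open>1 / real m\<close> is
    \<open>0\<close>; from \<open>m = 1\<close> on it is positive and the product stays minus
    infinity.\<close>
  have "ereal (1 / real m) * ext_ln (norm (W f ^ m)) = -\<infinity>" if "m \<ge> max n 1" for m
  proof -
    have "W f ^ m = W f ^ n * W f ^ (m - n)"
      using that by (simp flip: power_add)
    then show ?thesis using n that by (simp add: ext_ln_def)
  qed
  then have "\<forall>\<^sub>F m in sequentially. ereal (1 / real m) * ext_ln (norm (W f ^ m)) = -\<infinity>"
    unfolding eventually_at_top_linorder by blast
  then have "(\<lambda>m. ereal (1 / real m) * ext_ln (norm (W f ^ m))) \<longlonglongrightarrow> -\<infinity>"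
    by (rule tendsto_eventually)
  then have "spectral_potential J E f = -\<infinity>"
    unfolding spectral_potential_def by (rule limI)
  then show False using finite_potential[of f] by simp
qed

text \<open>The value of \<open>lim\<close> says nothing until convergence is known. It follows from
  \<open>fekete\<close>, since submultiplicativity of the norm makes
  \<open>ln (norm (W f ^ n))\<close> subadditive.\<close>

lemma lam_tendsto: "(\<lambda>n. ln (norm (W f ^ n)) / real n) \<longlonglongrightarrow> lam f"
proof -
  define a where "a n = ln (norm (W f ^ n))" for n
  have "a (m + n) \<le> a m + a n" for m n
  proof -
    have "a (m + n) \<le> ln (norm (W f ^ m) * norm (W f ^ n))"
      unfolding a_def
      using power_W_nonzero[of f "m + n"] power_W_nonzero[of f m] power_W_nonzero[of f n]
      by (subst ln_le_cancel_iff) (auto simp: power_add norm_mult_ineq)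
    also have "\<dots> = a m + a n"
      unfolding a_def using power_W_nonzero by (subst ln_mult) auto
    finally show ?thesis .
  qed
  from fekete[of a, OF this] obtain l where l: "(\<lambda>n. ereal (a n / real n)) \<longlonglongrightarrow> l"
    by blast
  have "(\<lambda>n. ereal (1 / real n) * ext_ln (norm (W f ^ n))) = (\<lambda>n. ereal (a n / real n))"
    using power_W_nonzero by (simp add: ext_ln_def a_def)
  then have "spectral_potential J E f = l"
    unfolding spectral_potential_def using l by (simp add: limI)
  then have "(\<lambda>n. ereal (a n / real n)) \<longlonglongrightarrow> ereal (lam f)"
    using l by (simp add: spectral_potential_eq)
  then show ?thesis by (simp add: a_def)
qed

text \<open>Together with \<open>lam_leI\<close> this reduces an inequality for \<open>lam\<close>
  to one for norms of powers, at an arbitrarily small loss in the exponent.\<close>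

lemma eventually_norm_power_W_le:
  assumes "lam f < c"
  shows "\<forall>\<^sub>F n in sequentially. norm (W f ^ n) \<le> exp (real n * c)"
  using order_tendstoD(2)[OF lam_tendsto assms] eventually_ge_at_top[of 1]
proof eventually_elim
  case (elim n)
  then have "ln (norm (W f ^ n)) \<le> real n * c" by (simp add: field_simps)
  then have "exp (ln (norm (W f ^ n))) \<le> exp (real n * c)" by simp
  then show ?case using power_W_nonzero[of f n] by simp
qed

lemma lam_leI:
  assumes "\<forall>\<^sub>F n in sequentially. norm (W f ^ n) \<le> exp (real n * c)"
  shows "lam f \<le> c"
proof (rule tendsto_upperbound[OF lam_tendsto _ sequentially_bot])
  show "\<forall>\<^sub>F n in sequentially. ln (norm (W f ^ n)) / real n \<le> c"
    using assms eventually_ge_at_top[of 1]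
  proof eventually_elim
    case (elim n)
    then have "ln (norm (W f ^ n)) \<le> ln (exp (real n * c))"
      using power_W_nonzero[of f n] by (subst ln_le_cancel_iff) auto
    then show ?case using elim by (simp add: field_simps)
  qed
qed

text \<open>The Birkhoff sums of \<open>f\<close> and \<open>g\<close> differ by at most
  \<open>n * norm (f - g)\<close>, so their exponentials differ by at most the factor
  \<open>?c\<close>. The Lipschitz bound later yields continuity of functionals dominated by
  \<open>lam\<close> up to a constant.\<close>

lemma lam_le_add_norm: "lam f \<le> lam g + norm (f - g)"
proof (rule field_le_epsilon)
  fix e :: real assume "0 < e"
  then have "\<forall>\<^sub>F n in sequentially. norm (W g ^ n) \<le> exp (real n * (lam g + e))"
    by (intro eventually_norm_power_W_le) simp
  then have "\<forall>\<^sub>F n in sequentially. norm (W f ^ n) \<le> exp (real n * (lam g + norm (f - g) + e))"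
  proof eventually_elim
    case (elim n)
    let ?c = "exp (real n * norm (f - g))"
    have "S n f x \<le> real n * norm (f - g) + S n g x" for x
    proof -
      have "S n f x \<le> (\<Sum>i<n. norm (f - g) + g ((\<alpha> ^^ i) x))"
        unfolding S_apply
      proof (rule sum_mono)
        fix i
        show "f ((\<alpha> ^^ i) x) \<le> norm (f - g) + g ((\<alpha> ^^ i) x)"
          using norm_bounded[of "f - g" "(\<alpha> ^^ i) x"] by (simp add: abs_le_iff)
      qed
      then show ?thesis by (simp add: S_apply sum.distrib)
    qed
    then have "norm (W f ^ n) \<le> norm (J (?c *\<^sub>R cfun_exp (S n g)) * E ^ n)"
      unfolding power_W by (intro norm_J_mult_mono) (auto simp flip: exp_add)
    also have "\<dots> = ?c * norm (W g ^ n)"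
      by (simp add: power_W linear_scale[OF linear_J])
    also have "\<dots> \<le> ?c * exp (real n * (lam g + e))"
      using elim by (intro mult_left_mono) auto
    also have "\<dots> = exp (real n * (lam g + norm (f - g) + e))"
      by (simp add: algebra_simps flip: exp_add)
    finally show ?case .
  qed
  then show "lam f \<le> lam g + norm (f - g) + e" by (rule lam_leI)
qed

text \<open>Log-convexity comes from convexity of the exponential once \<open>S n f\<close> and \<open>S n g\<close> are shifted
  by \<open>n * c\<close> and \<open>n * d\<close>, which brings the two norms to the same exponential scale.\<close>

lemma convex_lam: "convex_on UNIV lam"
proof (rule convex_onI)
  fix t :: real and f g :: "'x \<Rightarrow>\<^sub>C real"
  assume t: "0 < t" "t < 1"
  let ?h = "(1 - t) *\<^sub>R f + t *\<^sub>R g"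
  show "lam ?h \<le> (1 - t) * lam f + t * lam g"
  proof (rule field_le_epsilon)
    fix e :: real assume e: "0 < e"
    define c d where "c = lam f + e" and "d = lam g + e"
    have "\<forall>\<^sub>F n in sequentially. norm (W f ^ n) \<le> exp (real n * c)"
      "\<forall>\<^sub>F n in sequentially. norm (W g ^ n) \<le> exp (real n * d)"
      using e by (auto simp: c_def d_def intro!: eventually_norm_power_W_le)
    then have "\<forall>\<^sub>F n in sequentially. norm (W ?h ^ n) \<le> exp (real n * ((1 - t) * c + t * d))"
    proof eventually_elim
      case (elim n)
      \<comment> \<open>\<open>?k\<close> is the bound aimed at. The scalars in \<open>?u\<close>
        and \<open>?v\<close> are chosen so that these functions contribute at most
        \<open>(1 - t) * ?k\<close> and \<open>t * ?k\<close> to the norm.\<close>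
      let ?k = "exp (real n * ((1 - t) * c + t * d))"
      let ?u = "((1 - t) * ?k * exp (- real n * c)) *\<^sub>R cfun_exp (S n f)"
      let ?v = "(t * ?k * exp (- real n * d)) *\<^sub>R cfun_exp (S n g)"
      have "exp (S n ?h x) \<le> (?u + ?v) x" for x
      proof -
        let ?a = "S n f x - real n * c" and ?b = "S n g x - real n * d"
        have "exp ((1 - t) *\<^sub>R ?a + t *\<^sub>R ?b) \<le> (1 - t) * exp ?a + t * exp ?b"
          using t by (intro convex_onD[OF exp_convex]) auto
        then have "?k * exp ((1 - t) *\<^sub>R ?a + t *\<^sub>R ?b) \<le> ?k * ((1 - t) * exp ?a + t * exp ?b)"
          by (intro mult_left_mono) auto
        moreover have "?k * exp ((1 - t) *\<^sub>R ?a + t *\<^sub>R ?b) = exp (S n ?h x)"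
          unfolding S_add S_scaleR by (simp add: algebra_simps flip: exp_add)
        moreover have "?k * ((1 - t) * exp ?a + t * exp ?b) = (?u + ?v) x"
          by (simp add: exp_diff exp_minus field_simps)
        ultimately show ?thesis by simp
      qed
      then have "norm (W ?h ^ n) \<le> norm (J (?u + ?v) * E ^ n)"
        unfolding power_W by (intro norm_J_mult_mono) auto
      also have "J (?u + ?v) * E ^ n
          = ((1 - t) * ?k * exp (- real n * c)) *\<^sub>R W f ^ n + (t * ?k * exp (- real n * d)) *\<^sub>R W g ^ n"
        by (simp add: power_W linear_scale[OF linear_J]
            linear_add[OF linear_J] ring_distribs)
      also have "norm \<dots> \<le> ((1 - t) * ?k * exp (- real n * c)) * norm (W f ^ n)
          + (t * ?k * exp (- real n * d)) * norm (W g ^ n)"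
        using t by (intro norm_triangle_le) (simp add: abs_mult)
      also have "\<dots> \<le> ((1 - t) * ?k * exp (- real n * c)) * exp (real n * c)
          + (t * ?k * exp (- real n * d)) * exp (real n * d)"
        using t elim by (intro add_mono mult_left_mono) auto
      also have "\<dots> = ?k" by (simp add: exp_minus field_simps)
      finally show ?case .
    qed
    then have "lam ?h \<le> (1 - t) * c + t * d" by (rule lam_leI)
    then show "lam ?h \<le> (1 - t) * lam f + t * lam g + e"
      by (simp add: c_def d_def algebra_simps)
  qed
qed simp

end

section \<open>States, entropy and tilted measures\<close>

lemma dual_onD:
  assumes "u \<in> dual_on L"
  shows "u \<in> extensional L"
    and "\<And>f g. f \<in> L \<Longrightarrow> g \<in> L \<Longrightarrow> u (f + g) = u f + u g"
    and "\<And>c f. f \<in> L \<Longrightarrow> u (c *\<^sub>R f) = c * u f"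
  using assms by (auto simp: dual_on_def)

text \<open>Linearity and the norm bound give a Lipschitz function, so continuity is automatic.
  Conversely, a norm-bounded function on \<open>L\<close> outside the dual must violate additivity
  or homogeneity.\<close>

lemma dual_onI:
  assumes L: "subspace L" and ext: "u \<in> extensional L"
    and add: "\<And>f g. f \<in> L \<Longrightarrow> g \<in> L \<Longrightarrow> u (f + g) = u f + u g"
    and scale: "\<And>c f. f \<in> L \<Longrightarrow> u (c *\<^sub>R f) = c * u f"
    and bound: "\<And>f. f \<in> L \<Longrightarrow> \<bar>u f\<bar> \<le> norm f"
  shows "u \<in> dual_on L"
proof -
  have "1-lipschitz_on L u"
  proof (rule lipschitz_onI)
    fix f g assume fg: "f \<in> L" "g \<in> L"
    have "u (f + (-1) *\<^sub>R g) = u f + (-1) * u g"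
      using fg subspace_scale[OF L, of g "-1"] by (simp only: add scale)
    then show "dist (u f) (u g) \<le> 1 * dist f g"
      using bound[OF subspace_diff[OF L fg]] by (simp add: dist_norm)
  qed simp
  then have "continuous_on L u" by (rule lipschitz_on_continuous_on)
  then show ?thesis using assms by (simp add: dual_on_def)
qed

locale weighted_flow_state = weighted_flow K E J \<alpha>
  for K :: "'a::real_normed_algebra_1 set" and E :: 'a
    and J :: "('x::t2_space \<Rightarrow>\<^sub>C real) \<Rightarrow> 'a" and \<alpha> :: "'x \<Rightarrow> 'x" +
  fixes \<nu> :: "'a \<Rightarrow>\<^sub>L real"
  assumes state_nu: "state K \<nu>"
begin

abbreviation N :: "('x \<Rightarrow>\<^sub>C real) \<Rightarrow> nat \<Rightarrow> real" where
  "N f n \<equiv> blinfun_apply \<nu> (W f ^ n)"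

text \<open>The gap between \<open>d\<close> and \<open>c\<close> absorbs the constant
  \<open>norm \<nu>\<close>, so every state obeys this upper bound. Sensitivity supplies the
  matching lower bound in \<open>eventually_less_N\<close>.\<close>

lemma eventually_N_le:
  assumes "lam f < c"
  shows "\<forall>\<^sub>F n in sequentially. N f n \<le> exp (real n * c)"
proof -
  obtain d where d: "lam f < d" "d < c" using dense assms by blast
  have "filterlim (\<lambda>n. exp ((c - d) * real n)) at_top sequentially"
    using d by (intro filterlim_compose[OF exp_at_top]
      filterlim_tendsto_pos_mult_at_top[OF tendsto_const _ filterlim_real_sequentially]) simp
  then have "\<forall>\<^sub>F n in sequentially. norm \<nu> \<le> exp (real n * (c - d))"
    by (simp add: filterlim_at_top mult.commute)
  then show ?thesis
    using eventually_norm_power_W_le[OF d(1)]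
  proof eventually_elim
    case (elim n)
    have "N f n \<le> norm \<nu> * norm (W f ^ n)"
      using norm_blinfun[of \<nu> "W f ^ n"] by simp
    also have "\<dots> \<le> exp (real n * (c - d)) * exp (real n * d)"
      using elim by (intro mult_mono) auto
    also have "\<dots> = exp (real n * c)" by (simp add: algebra_simps flip: exp_add)
    finally show ?case .
  qed
qed

lemma eventually_less_N:
  assumes "sensitive J E \<nu> f" "c < lam f"
  shows "\<forall>\<^sub>F n in sequentially. exp (real n * c) < N f n"
proof -
  have "\<forall>\<^sub>F n in sequentially. ereal c < ereal (1 / real n) * ext_ln (N f n)"
    using assms by (intro order_tendstoD(1)) (auto simp: sensitive_def spectral_potential_eq)
  then show ?thesis
    using eventually_ge_at_top[of 1]
  proof eventually_elim
    case (elim n)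
    have "0 \<le> N f n" using state_nu power_W_in_K by (simp add: state_def)
    \<comment> \<open>At zero \<open>ext_ln\<close> is minus infinity, which contradicts the real
      lower bound \<open>c\<close>.\<close>
    moreover have "N f n \<noteq> 0" using elim by (auto simp: ext_ln_def)
    ultimately have pos: "0 < N f n" by simp
    then have "real n * c < ln (N f n)" using elim by (simp add: ext_ln_def field_simps)
    then have "exp (real n * c) < exp (ln (N f n))" by simp
    then show ?case using pos by simp
  qed
qed

lemma eventually_N_pos:
  assumes "sensitive J E \<nu> f"
  shows "\<forall>\<^sub>F n in sequentially. 0 < N f n"
  using eventually_less_N[OF assms, of "lam f - 1"]
  by (auto elim: eventually_mono intro: less_trans[OF exp_gt_zero])

section \<open>Duality between the conditional action and potentials in \<open>L\<close>\<close>

text \<open>If no such \<psi> existed, \<open>u\<close> would lie below \<open>lam - c\<close> on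
  \<open>L\<close>. Its Hahn-Banach extension \<open>U\<close> below the same convex function has
  dual entropy at least \<open>c\<close>, hence action at least \<open>t\<close>, contrary to the
  assumption on the supremum.\<close>

lemma exists_potential_below_conditional_action:
  assumes L: "subspace L" and \<phi>: "\<phi> \<in> L" and u: "u \<in> dual_on L"
    and t: "conditional_action J E L \<phi> u < ereal t"
  shows "\<exists>\<psi>\<in>L. u \<phi> + (lam \<psi> - u \<psi>) - lam \<phi> < t"
proof (rule ccontr)
  assume neg: "\<not> ?thesis"
  define c where "c = t + lam \<phi> - u \<phi>"
  have le: "u \<psi> \<le> lam \<psi> - c" if "\<psi> \<in> L" for \<psi>
    using neg that by (force simp: c_def)
  have cvx: "convex_on UNIV (\<lambda>\<psi>. lam \<psi> - c)"
    using convex_on_add[OF convex_lam, of "\<lambda>_. - c"] by (simp add: convex_on_const)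
  obtain U where U: "linear U" "\<And>\<psi>. \<psi> \<in> L \<Longrightarrow> U \<psi> = u \<psi>" "\<And>\<psi>. U \<psi> \<le> lam \<psi> - c"
    using hahn_banach_convex[OF cvx L dual_onD(2,3)[OF u] le] by blast
  \<comment> \<open>Along the ray through \<open>f\<close> the majorant grows at most at rate
    \<open>norm f\<close>. The factor \<open>s\<close> makes the linear excess equal to
    \<open>\<bar>lam 0 - c\<bar> + 1\<close>, more than the constants allow.\<close>
  have U_le: "U f \<le> norm f" for f
  proof (rule ccontr)
    assume "\<not> U f \<le> norm f"
    then have pos: "0 < U f - norm f" by simp
    define s where "s = (\<bar>lam 0 - c\<bar> + 1) / (U f - norm f)"
    have s: "0 < s" using pos by (simp add: s_def)
    have "s * U f = U (s *\<^sub>R f)" using U(1) by (simp add: linear_scale)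
    also have "\<dots> \<le> lam 0 + s * norm f - c"
      using U(3)[of "s *\<^sub>R f"] lam_le_add_norm[of "s *\<^sub>R f" 0] s by simp
    finally have "s * (U f - norm f) \<le> lam 0 - c" by (simp add: algebra_simps)
    then show False using pos by (simp add: s_def)
  qed
  have "bounded_linear U"
  proof (rule bounded_linear_intro[of _ 1])
    show "norm (U f) \<le> norm f * 1" for f
      using U_le[of f] U_le[of "- f"] U(1) by (simp add: linear_neg abs_le_iff)
  qed (use U(1) in \<open>auto simp: linear_add linear_scale\<close>)
  then have app: "blinfun_apply (Blinfun U) = U" by (rule bounded_linear_Blinfun_apply)
  have "restrict (blinfun_apply (Blinfun U)) L = u"
    using U(2) dual_onD(1)[OF u] by (auto simp: app restrict_def extensional_def)
  then have "action J E \<phi> (Blinfun U) \<le> conditional_action J E L \<phi> u"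
    unfolding conditional_action_def by (intro SUP_upper) simp
  moreover have "ereal t \<le> action J E \<phi> (Blinfun U)"
  proof -
    have "ereal c \<le> dual_entropy J E (Blinfun U)"
      unfolding dual_entropy_def
    proof (rule INF_greatest)
      show "ereal c \<le> spectral_potential J E \<psi> - ereal (blinfun_apply (Blinfun U) \<psi>)" for \<psi>
        using U(3)[of \<psi>] by (simp add: app spectral_potential_eq)
    qed
    then have "ereal (U \<phi>) + ereal c - ereal (lam \<phi>) \<le> action J E \<phi> (Blinfun U)"
      unfolding action_def app spectral_potential_eq by (intro ereal_minus_mono add_mono) auto
    then show ?thesis using U(2)[OF \<phi>] by (simp add: c_def)
  qed
  ultimately show False using t by simp
qed

text \<open>Choosing \<psi> in the infimum that defines the entropy bounds the action of every
  extension of \<open>u\<close>. For a subgradient \<open>u\<close> at \<psi> this converts a lower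
  bound on the action into an upper bound on \<open>u (\<psi> - \<phi>)\<close>, the exponential
  rate of the tilting density.\<close>

lemma conditional_action_subgradient_le:
  assumes "\<psi> \<in> L" "\<phi> \<in> L"
  shows "conditional_action J E L \<phi> u \<le> ereal (u \<phi> + (lam \<psi> - u \<psi>) - lam \<phi>)"
  unfolding conditional_action_def
proof (rule SUP_least)
  fix \<mu> assume "\<mu> \<in> {\<mu>. restrict (blinfun_apply \<mu>) L = u}"
  then have eq: "blinfun_apply \<mu> \<phi> = u \<phi>" "blinfun_apply \<mu> \<psi> = u \<psi>"
    using assms by auto
  have "dual_entropy J E \<mu> \<le> ereal (lam \<psi> - u \<psi>)"
    unfolding dual_entropy_def using eq
    by (intro INF_lower2[of \<psi>]) (auto simp: spectral_potential_eq)
  then have "action J E \<phi> \<mu> \<le> ereal (u \<phi>) + ereal (lam \<psi> - u \<psi>) - ereal (lam \<phi>)"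
    unfolding action_def eq spectral_potential_eq by (intro ereal_minus_mono add_mono) auto
  then show "action J E \<phi> \<mu> \<le> ereal (u \<phi> + (lam \<psi> - u \<psi>) - lam \<phi>)" by simp
qed

text \<open>Finiteness of the total mass suffices: taking \<open>g = 1\<close> shows that it is \<open>1\<close>.\<close>

definition represents :: "'x measure \<Rightarrow> ('x \<Rightarrow>\<^sub>C real) \<Rightarrow> nat \<Rightarrow> bool" where
  "represents M f n \<longleftrightarrow> finite_measure M \<and> sets M = sets borel \<and> 0 < N f n \<and>
     (\<forall>g. integral\<^sup>L M (apply_bcontfun g) = weighted_functional J E \<nu> f n g)"

lemma representsD:
  assumes "represents M f n"
  shows "finite_measure M" "sets M = sets borel" "space M = UNIV" "0 < N f n"
    "\<And>g. integral\<^sup>L M (apply_bcontfun g) = weighted_functional J E \<nu> f n g"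
  using assms sets_eq_imp_space_eq[of M borel] by (auto simp: represents_def)

lemma measurable_bcontfun [simp]:
  assumes "represents M f n"
  shows "apply_bcontfun g \<in> borel_measurable M"
proof -
  have "apply_bcontfun g \<in> borel_measurable borel"
    by (intro borel_measurable_continuous_onI) simp
  then show ?thesis using measurable_cong_sets[OF representsD(2)[OF assms] refl] by auto
qed

lemma integrable_bcontfun:
  assumes "represents M f n"
  shows "integrable M (apply_bcontfun (g :: 'x \<Rightarrow>\<^sub>C real))"
  by (rule finite_measure.integrable_const_bound[OF representsD(1)[OF assms], of _ "norm g"])
    (use assms norm_bounded[of g] in auto)

text \<open>Additivity of Birkhoff sums and multiplicativity of \<open>J\<close> turn a change of
  weight by \<open>h\<close> into insertion of the factor \<open>exp (S n h x)\<close>.\<close>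

lemma J_mult_power_W_add:
  "J g * W (f + h) ^ n = J (cfun_mult (cfun_exp (S n h)) g) * W f ^ n"
proof -
  have "cfun_mult g (cfun_exp (S n (f + h)))
      = cfun_mult (cfun_mult (cfun_exp (S n h)) g) (cfun_exp (S n f))"
    by (rule bcontfun_eqI) (simp add: S_add exp_add)
  then have "J g * J (cfun_exp (S n (f + h)))
      = J (cfun_mult (cfun_exp (S n h)) g) * J (cfun_exp (S n f))"
    by (simp flip: J_mult)
  then show ?thesis by (simp add: power_W flip: mult.assoc)
qed

lemma weighted_functional_mult_exp:
  "weighted_functional J E \<nu> f n (cfun_mult (cfun_exp (S n h)) g)
     = blinfun_apply \<nu> (J g * W (f + h) ^ n) / N f n"
  by (simp add: weighted_functional_def J_mult_power_W_add)

lemma integral_exp_S: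
  assumes "represents M f n"
  shows "integral\<^sup>L M (\<lambda>x. exp (S n h x)) = N (f + h) n / N f n"
proof -
  have "(\<lambda>x. exp (S n h x)) = apply_bcontfun (cfun_mult (cfun_exp (S n h)) (const_bcontfun 1))"
    by (rule ext) simp
  then show ?thesis
    using representsD(5)[OF assms] by (simp only: weighted_functional_mult_exp J_one mult_1_left)
qed

text \<open>Chernoff's bound: Markov's inequality for \<open>exp (S n h x)\<close>, whose integral
  is known exactly from \<open>integral_exp_S\<close>.\<close>

lemma measure_S_ge_le:
  assumes M: "represents M f n"
  shows "measure M {x. b \<le> S n h x} \<le> exp (- b) * (N (f + h) n / N f n)"
proof -
  have int: "integrable M (\<lambda>x. exp (S n h x))"
    using integrable_bcontfun[OF M, of "cfun_exp (S n h)"] by (simp add: cfun_exp_apply[abs_def])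
  have "measure M {x \<in> space M. exp b \<le> exp (S n h x)} \<le> (\<integral>x. exp (S n h x) \<partial>M) / exp b"
    by (rule integral_Markov_inequality_measure[OF int sets.empty_sets]) auto
  then show ?thesis
    unfolding integral_exp_S[OF M] by (simp add: representsD(3)[OF M] exp_minus field_simps)
qed

text \<open>The scalar factor normalizes the density: when both values of the state are positive,
  tilting by \<open>h\<close> carries the measure of \<open>f\<close> to the probability measure of
  \<open>f + h\<close>.\<close>

definition tilt :: "'x measure \<Rightarrow> ('x \<Rightarrow>\<^sub>C real) \<Rightarrow> ('x \<Rightarrow>\<^sub>C real) \<Rightarrow> nat \<Rightarrow> 'x measure" where
  "tilt M f h n = density M (\<lambda>x. ennreal (N f n / N (f + h) n * exp (S n h x)))"

text \<open>The inequality holds because the density is bounded on \<open>A\<close>. It is used in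
  reverse: large tilted mass of \<open>A\<close> forces a lower bound on the original mass.\<close>

lemma
  assumes M: "represents M f n" and pos: "0 < N (f + h) n"
  shows represents_tilt: "represents (tilt M f h n) (f + h) n"
    and measure_tilt_le: "\<And>A b. A \<in> sets borel \<Longrightarrow> (\<And>x. x \<in> A \<Longrightarrow> S n h x \<le> b) \<Longrightarrow>
      measure (tilt M f h n) A \<le> N f n / N (f + h) n * exp b * measure M A"
proof -
  define w where "w x = N f n / N (f + h) n * exp (S n h x)" for x
  have w_eq: "w = apply_bcontfun ((N f n / N (f + h) n) *\<^sub>R cfun_exp (S n h))"
    by (rule ext) (simp add: w_def)
  have w_meas [measurable]: "w \<in> borel_measurable M"
    unfolding w_eq by (rule measurable_bcontfun[OF M])
  have w_int: "integrable M w" unfolding w_eq by (rule integrable_bcontfun[OF M])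
  have w_nn: "0 \<le> w x" for x using pos representsD(4)[OF M] by (simp add: w_def)
  have t: "tilt M f h n = density M (\<lambda>x. ennreal (w x))" by (simp add: tilt_def w_def)
  have fin: "finite_measure (tilt M f h n)"
  proof (rule finite_measureI)
    have "emeasure (tilt M f h n) (space M) = (\<integral>\<^sup>+x. ennreal (w x) \<partial>M)"
      unfolding t by (subst emeasure_density) (auto intro!: nn_integral_cong)
    also have "\<dots> = ennreal (integral\<^sup>L M w)"
      using w_int w_nn by (intro nn_integral_eq_integral) auto
    finally show "emeasure (tilt M f h n) (space (tilt M f h n)) \<noteq> \<infinity>" by (simp add: t)
  qed
  show "represents (tilt M f h n) (f + h) n"
    unfolding represents_def
  proof (intro conjI allI fin pos)
    show "sets (tilt M f h n) = sets borel" by (simp add: t representsD(2)[OF M])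
    fix g :: "'x \<Rightarrow>\<^sub>C real"
    have "integral\<^sup>L (tilt M f h n) (apply_bcontfun g) = (\<integral>x. w x *\<^sub>R g x \<partial>M)"
      unfolding t by (rule integral_density[OF measurable_bcontfun[OF M] w_meas]) (simp add: w_nn)
    also have "\<dots> = (\<integral>x. N f n / N (f + h) n * cfun_mult (cfun_exp (S n h)) g x \<partial>M)"
      by (simp add: w_def mult.assoc)
    also have "\<dots> = N f n / N (f + h) n * (\<integral>x. cfun_mult (cfun_exp (S n h)) g x \<partial>M)"
      by (rule integral_mult_right_zero)
    also have "\<dots> = weighted_functional J E \<nu> (f + h) n g"
      using representsD(4)[OF M]
      by (simp only: representsD(5)[OF M] weighted_functional_mult_exp)
        (simp add: weighted_functional_def)
    finally show "integral\<^sup>L (tilt M f h n) (apply_bcontfun g) = weighted_functional J E \<nu> (f + h) n g" .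
  qed
  fix A b assume A: "A \<in> sets borel" and b: "\<And>x. x \<in> A \<Longrightarrow> S n h x \<le> b"
  have AM [measurable]: "A \<in> sets M" using A representsD(2)[OF M] by simp
  have finM: "emeasure M A < \<infinity>"
    using finite_measure.emeasure_finite[OF representsD(1)[OF M], of A] by (simp add: less_top)
  have "measure (tilt M f h n) A = integral\<^sup>L (tilt M f h n) (indicator A)"
    using AM by (simp add: t)
  also have "\<dots> = (\<integral>x. w x *\<^sub>R (indicator A x :: real) \<partial>M)"
    unfolding t using w_nn by (intro integral_density) auto
  also have "\<dots> \<le> (\<integral>x. (N f n / N (f + h) n * exp b) * indicator A x \<partial>M)"
  proof (rule integral_mono)
    show "integrable M (\<lambda>x. w x *\<^sub>R (indicator A x :: real))"
      using integrable_mult_indicator[OF AM w_int] by (simp add: mult.commute)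
    show "integrable M (\<lambda>x. (N f n / N (f + h) n * exp b) * indicator A x)"
      using finM AM by (intro integrable_mult_right integrable_real_indicator) auto
    show "w x *\<^sub>R (indicator A x :: real) \<le> (N f n / N (f + h) n * exp b) * indicator A x" for x
      using b[of x] pos representsD(4)[OF M]
      by (auto simp: w_def indicator_def intro!: mult_left_mono divide_nonneg_pos divide_right_mono)
  qed
  also have "\<dots> = N f n / N (f + h) n * exp b * measure M A"
    using AM by simp
  finally show "measure (tilt M f h n) A \<le> N f n / N (f + h) n * exp b * measure M A" .
qed

end

section \<open>Large deviations\<close>

context weighted_flow_state
begin

abbreviation Em :: "('x \<Rightarrow>\<^sub>C real) set \<Rightarrow> nat \<Rightarrow> 'x \<Rightarrow> ('x \<Rightarrow>\<^sub>C real) \<Rightarrow> real" where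
  "Em L n x \<equiv> restrict (empirical \<alpha> x n) L"

lemmas empirical_eq = empirical_eq_birkhoff[OF continuous_alpha]

lemma abs_empirical_le: "\<bar>empirical \<alpha> x n f\<bar> \<le> norm f"
proof -
  have "\<bar>S n f x\<bar> \<le> real n * norm f"
    unfolding S_apply using norm_bounded[of f]
    by (intro order_trans[OF sum_abs] order_trans[OF sum_bounded_above[of _ _ "norm f"]]) auto
  then show ?thesis
    by (cases "n = 0") (auto simp: empirical_eq field_simps)
qed

lemma empirical_in_dual_on:
  assumes L: "subspace L"
  shows "Em L n x \<in> dual_on L"
proof (rule dual_onI[OF L])
  show "\<bar>Em L n x f\<bar> \<le> norm f" if "f \<in> L" for f
    using that abs_empirical_le by simp
qed (auto simp: empirical_eq S_add S_scaleR add_divide_distrib subspace_add[OF L] subspace_scale[OF L])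

text \<open>Each coordinate is a Birkhoff sum divided by \<open>n\<close>, so the empirical map is
  continuous. The events are therefore Borel, which matters since \<open>measure\<close> is
  \<open>0\<close> on sets that are not measurable.\<close>

lemma open_empirical_preimage:
  assumes "openin (product_topology (\<lambda>_. euclideanreal) L) T"
  shows "open {x. Em L n x \<in> T}"
proof -
  have "continuous_map euclidean euclideanreal (\<lambda>x. Em L n x f)" if "f \<in> L" for f
    using that by (auto simp: empirical_eq divide_inverse intro!: continuous_intros)
  then have "continuous_map euclidean (product_topology (\<lambda>_. euclideanreal) L) (Em L n)"
    by (auto simp: continuous_map_componentwise)
  from openin_continuous_map_preimage[OF this assms] show ?thesis by simp
qed

lemma openin_halfspace:
  assumes "f \<in> L"
  shows "openin (product_topology (\<lambda>_. euclideanreal) L)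
    {v \<in> topspace (product_topology (\<lambda>_. euclideanreal) L). b < v f}"
    "openin (product_topology (\<lambda>_. euclideanreal) L)
    {v \<in> topspace (product_topology (\<lambda>_. euclideanreal) L). v f < b}"
  using openin_continuous_map_preimage[OF continuous_map_product_projection[OF assms], of "\<lambda>_. euclideanreal" "{b<..}"]
    openin_continuous_map_preimage[OF continuous_map_product_projection[OF assms], of "\<lambda>_. euclideanreal" "{..<b}"]
  by simp_all

section \<open>Upper bound near a single functional\<close>

text \<open>A nearly optimal \<psi> allows a single half-space as the neighbourhood. On it
  \<open>S n \<eta> x\<close> is at least \<open>n * (u \<eta> - e)\<close>, and
  \<open>measure_S_ge_le\<close> applies with \<psi> as the shifted weight.\<close>

lemma eventually_measure_empirical_less:
  assumes L: "subspace L" and \<phi>: "\<phi> \<in> L" and sens: "sensitive J E \<nu> \<phi>"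
    and P: "\<And>n. 0 < N \<phi> n \<Longrightarrow> represents (P n) \<phi> n"
    and u: "u \<in> dual_on L" and t: "conditional_action J E L \<phi> u < ereal t"
  shows "\<exists>V. openin (weak_star_on L) V \<and> u \<in> V \<and>
    (\<forall>\<^sub>F n in sequentially. measure (P n) {x. Em L n x \<in> V} < exp (real n * t))"
proof -
  obtain \<psi> where \<psi>: "\<psi> \<in> L" "u \<phi> + (lam \<psi> - u \<psi>) - lam \<phi> < t"
    using exists_potential_below_conditional_action[OF L \<phi> u t] by blast
  define \<eta> where "\<eta> = \<psi> - \<phi>"
  have \<eta>: "\<eta> \<in> L" using L \<psi> \<phi> by (simp add: \<eta>_def subspace_diff)
  have "u (\<eta> + \<phi>) = u \<eta> + u \<phi>" using dual_onD(2)[OF u \<eta> \<phi>] .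
  then have u\<eta>: "u \<eta> = u \<psi> - u \<phi>" by (simp add: \<eta>_def)
  \<comment> \<open>Three quarters of the gap are spent on the two estimates of the state and on the
    width of the half-space; the last one gives strict inequality.\<close>
  define e where "e = (t - (lam \<psi> - lam \<phi> - u \<eta>)) / 4"
  have e: "0 < e" using \<psi>(2) by (simp add: e_def u\<eta>)
  have low: "\<forall>\<^sub>F n in sequentially. exp (real n * (lam \<phi> - e)) < N \<phi> n"
    using e by (intro eventually_less_N[OF sens]) simp
  have up: "\<forall>\<^sub>F n in sequentially. N \<psi> n \<le> exp (real n * (lam \<psi> + e))"
    using e by (intro eventually_N_le) simp
  define H where "H = {v \<in> topspace (product_topology (\<lambda>_. euclideanreal) L). u \<eta> - e < v \<eta>}"
  define V where "V = H \<inter> dual_on L"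
  have "openin (weak_star_on L) V"
    unfolding weak_star_on_def V_def H_def
    by (intro openin_subtopology_Int openin_halfspace \<eta>)
  moreover have "u \<in> V"
    using u e by (simp add: V_def H_def PiE_def dual_onD(1))
  moreover have "\<forall>\<^sub>F n in sequentially. measure (P n) {x. Em L n x \<in> V} < exp (real n * t)"
    using low up eventually_ge_at_top[of 1] eventually_N_pos[OF sens]
  proof eventually_elim
    case (elim n)
    note M = P[OF elim(4)]
    interpret finite_measure "P n" using representsD(1)[OF M] .
    have "{x. real n * (u \<eta> - e) \<le> S n \<eta> x} \<in> sets borel"
      by (intro borel_closed closed_Collect_le) auto
    moreover have "{x. Em L n x \<in> V} \<subseteq> {x. real n * (u \<eta> - e) \<le> S n \<eta> x}"
      using elim(3) \<eta> by (auto simp: V_def H_def empirical_eq field_simps)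
    ultimately have "measure (P n) {x. Em L n x \<in> V} \<le> measure (P n) {x. real n * (u \<eta> - e) \<le> S n \<eta> x}"
      using representsD(2)[OF M] by (intro finite_measure_mono) auto
    also have "\<dots> \<le> exp (- (real n * (u \<eta> - e))) * (N (\<phi> + \<eta>) n / N \<phi> n)"
      by (rule measure_S_ge_le[OF M])
    also have "\<dots> \<le> exp (- (real n * (u \<eta> - e))) * (exp (real n * (lam \<psi> + e)) / exp (real n * (lam \<phi> - e)))"
      using elim e by (intro mult_left_mono frac_le) (auto simp: \<eta>_def)
    also have "\<dots> = exp (real n * (t - e))"
      by (simp add: e_def algebra_simps flip: exp_add exp_diff)
    also have "\<dots> < exp (real n * t)" using elim(3) e by simp
    finally show ?case .
  qed
  ultimately show ?thesis by blast
qed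

section \<open>Concentration at the subgradients\<close>

text \<open>A value above \<open>b\<close> violates the subgradient inequality at \<psi> in
  direction \<eta> by a fixed margin. The exponential moment is of order
  \<open>lam (\<psi> + \<eta>) - lam \<psi>\<close>, so the probability decays
  exponentially.\<close>

lemma tendsto_measure_deviation:
  assumes sens: "sensitive J E \<nu> \<psi>"
    and Q: "\<forall>\<^sub>F n in sequentially. represents (Q n) \<psi> n"
    and b: "lam (\<psi> + \<eta>) - lam \<psi> < b"
  shows "(\<lambda>n. measure (Q n) {x. b < empirical \<alpha> x n \<eta>}) \<longlonglongrightarrow> 0"
proof -
  \<comment> \<open>Two thirds of the margin cover the estimates of the two state values; the
    remaining third is the rate of decay.\<close>
  define e where "e = (b - (lam (\<psi> + \<eta>) - lam \<psi>)) / 3"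
  have e: "0 < e" using b by (simp add: e_def)
  have low: "\<forall>\<^sub>F n in sequentially. exp (real n * (lam \<psi> - e)) < N \<psi> n"
    using e by (intro eventually_less_N[OF sens]) simp
  have up: "\<forall>\<^sub>F n in sequentially. N (\<psi> + \<eta>) n \<le> exp (real n * (lam (\<psi> + \<eta>) + e))"
    using e by (intro eventually_N_le) simp
  have "filterlim (\<lambda>n. - (e * real n)) at_bot sequentially"
    using e by (simp add: filterlim_uminus_at_bot filterlim_tendsto_pos_mult_at_top[OF tendsto_const _ filterlim_real_sequentially])
  then have lim: "(\<lambda>n. exp (- (e * real n))) \<longlonglongrightarrow> 0"
    by (rule filterlim_compose[OF exp_at_bot])
  have "\<forall>\<^sub>F n in sequentially. measure (Q n) {x. b < empirical \<alpha> x n \<eta>} \<le> exp (- (e * real n))"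
    using low up eventually_ge_at_top[of 1] Q
  proof eventually_elim
    case (elim n)
    note M = elim(4)
    interpret finite_measure "Q n" using representsD(1)[OF M] .
    have "{x. real n * b \<le> S n \<eta> x} \<in> sets borel"
      by (intro borel_closed closed_Collect_le) auto
    moreover have "{x. b < empirical \<alpha> x n \<eta>} \<subseteq> {x. real n * b \<le> S n \<eta> x}"
      using elim(3) by (auto simp: empirical_eq field_simps)
    ultimately have "measure (Q n) {x. b < empirical \<alpha> x n \<eta>} \<le> measure (Q n) {x. real n * b \<le> S n \<eta> x}"
      using representsD(2)[OF M] by (intro finite_measure_mono) auto
    also have "\<dots> \<le> exp (- (real n * b)) * (N (\<psi> + \<eta>) n / N \<psi> n)"
      by (rule measure_S_ge_le[OF M])
    also have "\<dots> \<le> exp (- (real n * b)) * (exp (real n * (lam (\<psi> + \<eta>) + e)) / exp (real n * (lam \<psi> - e)))"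
      using elim e by (intro mult_left_mono frac_le) auto
    also have "\<dots> = exp (- (e * real n))"
    proof -
      have b_eq: "b = lam (\<psi> + \<eta>) - lam \<psi> + 3 * e" by (simp add: e_def field_simps)
      show ?thesis unfolding b_eq by (simp add: algebra_simps flip: exp_add exp_diff)
    qed
    finally show ?case .
  qed
  then show ?thesis
    by (intro tendsto_sandwich[OF _ _ tendsto_const lim]) auto
qed

text \<open>The empirical measures stay in the compact box \<open>PiE L (\<lambda>f. {- norm f..norm f})\<close>. Outside
  \<open>T\<close>, each point of the box has a neighbourhood of vanishing probability: either it violates
  linearity, which no empirical measure does, or it violates the subgradient inequality.\<close>

lemma tendsto_measure_subgradients:
  assumes sens: "sensitive J E \<nu> \<psi>" and L: "subspace L"
    and Q: "\<forall>\<^sub>F n in sequentially. represents (Q n) \<psi> n"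
    and T: "openin (product_topology (\<lambda>_. euclideanreal) L) T"
    and sub: "subgradients_on J E L \<psi> \<subseteq> T"
  shows "(\<lambda>n. measure (Q n) {x. Em L n x \<notin> T}) \<longlonglongrightarrow> 0"
proof -
  define X where "X = product_topology (\<lambda>_::'x \<Rightarrow>\<^sub>C real. euclideanreal) L"
  have topX: "topspace X = extensional L" by (simp add: X_def PiE_def)
  have emX: "Em L n x \<in> topspace X" for n x by (simp add: topX)
  define B where "B = PiE L (\<lambda>f. {- norm f..norm f})"
  have emB: "Em L n x \<in> B" for n x
    using abs_empirical_le[of x n] by (auto simp: B_def abs_le_iff minus_le_iff)
  have "compactin X B"
    unfolding X_def B_def by (simp add: compactin_PiE)
  then have comp: "compactin X (B - T)"
  proof -
    have "compactin X ((topspace X - T) \<inter> B)"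
      using T[folded X_def] \<open>compactin X B\<close> by (intro closed_Int_compactin closedin_diff) auto
    also have "(topspace X - T) \<inter> B = B - T"
      by (auto simp: topX B_def PiE_def)
    finally show ?thesis .
  qed
  \<comment> \<open>Finitely many sets of this family will cover the compact set, and a finite sum
    of null sequences is null.\<close>
  define \<G> where "\<G> = {G. openin X G \<and> (\<lambda>n. measure (Q n) {x. Em L n x \<in> G}) \<longlonglongrightarrow> 0}"
  have cov: "\<exists>G\<in>\<G>. v \<in> G" if v: "v \<in> B - T" for v
  proof (cases "v \<in> dual_on L")
    case True
    then have "v \<notin> subgradients_on J E L \<psi>" using v sub by blast
    then obtain \<eta> where \<eta>: "\<eta> \<in> L" "lam (\<psi> + \<eta>) - lam \<psi> < v \<eta>"
      using True by (auto simp: subgradients_on_def spectral_potential_eq not_le)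
    then obtain b where b: "lam (\<psi> + \<eta>) - lam \<psi> < b" "b < v \<eta>" using dense by blast
    define G where "G = {v \<in> topspace X. b < v \<eta>}"
    have "{x. Em L n x \<in> G} = {x. b < empirical \<alpha> x n \<eta>}" for n
      using \<eta>(1) emX by (auto simp: G_def)
    then have "G \<in> \<G>"
      using tendsto_measure_deviation[OF sens Q b(1)] openin_halfspace(1)[OF \<eta>(1)]
      by (simp add: \<G>_def G_def X_def)
    moreover have "v \<in> G" using v b(2) by (simp add: G_def topX B_def PiE_def)
    ultimately show ?thesis by blast
  next
    case False
    have vB: "v \<in> extensional L" "\<And>f. f \<in> L \<Longrightarrow> \<bar>v f\<bar> \<le> norm f"
      using v by (auto simp: B_def PiE_def Pi_def abs_le_iff minus_le_iff)
    have zero: "G \<in> \<G>" if "openin X G" "G \<inter> dual_on L = {}" for G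
    proof -
      have "{x. Em L n x \<in> G} = {}" for n
        using that(2) empirical_in_dual_on[OF L] by blast
      then show ?thesis using that(1) by (simp add: \<G>_def)
    qed
    have proj: "continuous_map X euclideanreal (\<lambda>v. v f)" if "f \<in> L" for f
      unfolding X_def using that by (rule continuous_map_product_projection)
    \<comment> \<open>By \<open>dual_onI\<close> continuity cannot fail in the box. A nonzero defect
      in additivity or homogeneity depends on finitely many coordinates, so it persists on an open
      set.\<close>
    consider f g where "f \<in> L" "g \<in> L" "v (f + g) \<noteq> v f + v g"
      | c f where "f \<in> L" "v (c *\<^sub>R f) \<noteq> c * v f"
      using False dual_onI[OF L vB(1) _ _ vB(2)] by blast
    then show ?thesis
    proof cases
      case 1
      define G where "G = {w \<in> topspace X. w (f + g) - (w f + w g) \<in> - {0}}"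
      have "openin X G"
        unfolding G_def using 1 subspace_add[OF L]
        by (intro openin_continuous_map_preimage[of X euclideanreal] continuous_intros proj) auto
      moreover have "G \<inter> dual_on L = {}" using 1 by (auto simp: G_def dual_onD(2))
      ultimately have "G \<in> \<G>" by (rule zero)
      moreover have "v \<in> G" using 1 vB(1) by (simp add: G_def topX)
      ultimately show ?thesis by blast
    next
      case 2
      define G where "G = {w \<in> topspace X. w (c *\<^sub>R f) - c * w f \<in> - {0}}"
      have "openin X G"
        unfolding G_def using 2 subspace_scale[OF L]
        by (intro openin_continuous_map_preimage[of X euclideanreal] continuous_intros proj) auto
      moreover have "G \<inter> dual_on L = {}" using 2 by (auto simp: G_def dual_onD(3))
      ultimately have "G \<in> \<G>" by (rule zero)
      moreover have "v \<in> G" using 2 vB(1) by (simp add: G_def topX)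
      ultimately show ?thesis by blast
    qed
  qed
  then have "B - T \<subseteq> \<Union>\<G>" by blast
  moreover have "\<And>G. G \<in> \<G> \<Longrightarrow> openin X G" by (simp add: \<G>_def)
  ultimately obtain \<F> where \<F>: "finite \<F>" "\<F> \<subseteq> \<G>" "B - T \<subseteq> \<Union>\<F>"
    using compactinD[OF comp, of \<G>] by metis
  have "(\<lambda>n. \<Sum>G\<in>\<F>. measure (Q n) {x. Em L n x \<in> G}) \<longlonglongrightarrow> (\<Sum>G\<in>\<F>. 0)"
    using \<F>(2) by (intro tendsto_sum) (auto simp: \<G>_def)
  then have lim: "(\<lambda>n. \<Sum>G\<in>\<F>. measure (Q n) {x. Em L n x \<in> G}) \<longlonglongrightarrow> 0" by simp
  have "\<forall>\<^sub>F n in sequentially. measure (Q n) {x. Em L n x \<notin> T} \<le> (\<Sum>G\<in>\<F>. measure (Q n) {x. Em L n x \<in> G})"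
    using Q
  proof eventually_elim
    case (elim n)
    interpret finite_measure "Q n" using representsD(1)[OF elim] .
    have meas: "{x. Em L n x \<in> G} \<in> sets (Q n)" if "G \<in> \<F>" for G
      using that \<F>(2) by (auto simp: representsD(2)[OF elim] \<G>_def X_def intro!: borel_open open_empirical_preimage)
    have "{x. Em L n x \<notin> T} \<subseteq> (\<Union>G\<in>\<F>. {x. Em L n x \<in> G})"
      using \<F>(3) emB by blast
    then have "measure (Q n) {x. Em L n x \<notin> T} \<le> measure (Q n) (\<Union>G\<in>\<F>. {x. Em L n x \<in> G})"
      using \<F>(1) meas by (intro finite_measure_mono) auto
    also have "\<dots> \<le> (\<Sum>G\<in>\<F>. measure (Q n) {x. Em L n x \<in> G})"
      using \<F>(1) meas by (intro finite_measure_subadditive_finite) auto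
    finally show ?case .
  qed
  then show ?thesis
    by (intro tendsto_sandwich[OF _ _ tendsto_const lim]) auto
qed

section \<open>Lower bound by change of measure\<close>

lemma eventually_measure_empirical_greater:
  assumes L: "subspace L" and \<phi>: "\<phi> \<in> L" and sens: "sensitive J E \<nu> \<phi>"
    and P: "\<And>n. 0 < N \<phi> n \<Longrightarrow> represents (P n) \<phi> n"
    and \<psi>: "\<psi> \<in> L" and sens': "sensitive J E \<nu> \<psi>"
    and U: "openin (weak_star_on L) U" and sub: "subgradients_on J E L \<psi> \<subseteq> U"
    and t: "ereal t < (INF u\<in>subgradients_on J E L \<psi>. conditional_action J E L \<phi> u)"
  shows "\<forall>\<^sub>F n in sequentially. exp (real n * t) < measure (P n) {x. Em L n x \<in> U}"
proof -
  define X where "X = product_topology (\<lambda>_::'x \<Rightarrow>\<^sub>C real. euclideanreal) L"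
  obtain T where T: "openin X T" "U = T \<inter> dual_on L"
    using U by (auto simp: weak_star_on_def openin_subtopology X_def)
  obtain s where s: "t < s" "ereal s < (INF u\<in>subgradients_on J E L \<psi>. conditional_action J E L \<phi> u)"
    using ereal_dense2[OF t] by auto
  define h where "h = \<psi> - \<phi>"
  have h: "h \<in> L" "\<phi> + h = \<psi>" using L \<psi> \<phi> by (simp_all add: h_def subspace_diff)
  \<comment> \<open>Since \<open>u h = u \<psi> - u \<phi>\<close>, the condition
    \<open>u h < a\<close> says that \<open>u \<phi> + (lam \<psi> - u \<psi>) - lam \<phi>\<close>
    exceeds \<open>s\<close>. Thus \<open>T'\<close> still contains all subgradients, while the
    tilting density on the corresponding event is bounded through \<open>a\<close>.\<close>
  define a where "a = lam \<psi> - lam \<phi> - s"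
  define T' where "T' = T \<inter> {v \<in> topspace X. v h < a}"
  have T': "openin X T'"
    unfolding T'_def X_def using T(1) openin_halfspace(2)[OF h(1)] by (intro openin_Int) (auto simp: X_def)
  have sub': "subgradients_on J E L \<psi> \<subseteq> T'"
  proof
    fix u assume u: "u \<in> subgradients_on J E L \<psi>"
    then have ud: "u \<in> dual_on L" by (simp add: subgradients_on_def)
    have "ereal s < conditional_action J E L \<phi> u"
      using s(2) INF_lower[OF u] by (rule less_le_trans)
    also have "\<dots> \<le> ereal (u \<phi> + (lam \<psi> - u \<psi>) - lam \<phi>)"
      by (rule conditional_action_subgradient_le[OF \<psi> \<phi>])
    finally have "u h < a"
      using dual_onD(2)[OF ud \<phi> h(1)] by (simp add: h(2) a_def)
    then show "u \<in> T'"
      using u sub dual_onD(1)[OF ud] by (auto simp: T'_def T(2) X_def PiE_def)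
  qed
  define Q where "Q n = tilt (P n) \<phi> h n" for n
  have Q: "\<forall>\<^sub>F n in sequentially. represents (Q n) \<psi> n"
    using eventually_N_pos[OF sens] eventually_N_pos[OF sens']
    by eventually_elim (use P represents_tilt[of _ \<phi> _ h] h(2) in \<open>auto simp: Q_def\<close>)
  have "\<forall>\<^sub>F n in sequentially. measure (Q n) {x. Em L n x \<notin> T'} < 1 / 2"
    using tendsto_measure_subgradients[OF sens' L Q T'[unfolded X_def] sub'] by (rule order_tendstoD) simp
  \<comment> \<open>With \<open>s = t + 3 * e\<close>, the two state estimates cost
    \<open>2 * e\<close> and leave the exponent \<open>t + e\<close>.\<close>
  define e where "e = (s - t) / 3"
  have e: "0 < e" using s by (simp add: e_def)
  have low: "\<forall>\<^sub>F n in sequentially. exp (real n * (lam \<psi> - e)) < N \<psi> n"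
    using e by (intro eventually_less_N[OF sens']) simp
  have up: "\<forall>\<^sub>F n in sequentially. N \<phi> n \<le> exp (real n * (lam \<phi> + e))"
    using e by (intro eventually_N_le) simp
  \<comment> \<open>The surplus factor \<open>exp (e * real n)\<close> eventually outweighs the loss
    of \<open>1 / 2\<close> in the tilted mass.\<close>
  have "filterlim (\<lambda>n. exp (e * real n)) at_top sequentially"
    using e by (intro filterlim_compose[OF exp_at_top]
      filterlim_tendsto_pos_mult_at_top[OF tendsto_const _ filterlim_real_sequentially]) simp
  then have "\<forall>\<^sub>F n in sequentially. 2 < exp (e * real n)"
    by (simp add: filterlim_at_top_dense)
  then show ?thesis
    using \<open>\<forall>\<^sub>F n in sequentially. measure (Q n) {x. Em L n x \<notin> T'} < 1 / 2\<close> Q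
      low up eventually_N_pos[OF sens] eventually_ge_at_top[of 1]
  proof eventually_elim
    case (elim n)
    let ?A = "{x. Em L n x \<in> T'}"
    note M = P[OF elim(6)]
    interpret P: finite_measure "P n" using representsD(1)[OF M] .
    interpret Q: finite_measure "Q n" using representsD(1)[OF elim(3)] .
    have A: "?A \<in> sets borel"
      using open_empirical_preimage[OF T'[unfolded X_def]] by (rule borel_open)
    have N\<psi>: "0 < N \<psi> n" using representsD(4)[OF elim(3)] .
    \<comment> \<open>Taking the exponent \<open>0\<close> in \<open>integral_exp_S\<close> makes
      the integrand constantly one and the two state values cancel.\<close>
    have mass: "measure (Q n) UNIV = 1"
      using integral_exp_S[OF elim(3), of 0] N\<psi> representsD(3)[OF elim(3)]
      by (simp add: S_apply)
    have "measure (Q n) (space (Q n) - ?A) = measure (Q n) (space (Q n)) - measure (Q n) ?A"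
      using A representsD(2)[OF elim(3)] by (intro Q.finite_measure_compl) simp
    then have "1 / 2 < measure (Q n) ?A"
      using elim(2) mass by (simp add: representsD(3)[OF elim(3)] Compl_eq_Diff_UNIV[symmetric] Collect_neg_eq[symmetric])
    also have "\<dots> \<le> N \<phi> n / N \<psi> n * exp (real n * a) * measure (P n) ?A"
    proof -
      have "S n h x \<le> real n * a" if "x \<in> ?A" for x
        using that elim(7) h(1) by (auto simp: T'_def empirical_eq field_simps)
      then show ?thesis
        using measure_tilt_le[OF M, of h ?A "real n * a"] N\<psi> A by (simp add: h(2) Q_def)
    qed
    also have "\<dots> \<le> exp (real n * (lam \<phi> + e)) / exp (real n * (lam \<psi> - e)) * exp (real n * a) * measure (P n) ?A"
      using elim by (intro mult_right_mono frac_le) auto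
    also have "\<dots> = exp (- (real n * (t + e))) * measure (P n) ?A"
      by (simp add: a_def e_def field_simps flip: exp_add exp_diff)
    finally have "exp (real n * (t + e)) < 2 * measure (P n) ?A"
      by (simp only: exp_minus) (simp add: field_simps)
    moreover have "2 * exp (real n * t) < exp (real n * (t + e))"
      using elim(1) by (simp add: distrib_left exp_add mult.commute)
    ultimately have "exp (real n * t) < measure (P n) ?A" by simp
    also have "\<dots> \<le> measure (P n) {x. Em L n x \<in> U}"
    proof (rule P.finite_measure_mono)
      have eq: "{x. Em L n x \<in> U} = {x. Em L n x \<in> T}"
        using empirical_in_dual_on[OF L] by (auto simp: T(2))
      show "?A \<subseteq> {x. Em L n x \<in> U}" unfolding eq by (auto simp: T'_def)
      show "{x. Em L n x \<in> U} \<in> sets (P n)"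
        unfolding eq representsD(2)[OF M]
        using open_empirical_preimage[OF T(1)[unfolded X_def]] by (rule borel_open)
    qed
    finally show ?case .
  qed
qed

end

section \<open>Passage from the phase subalgebra to C(X)\<close>

text \<open>Both sides of the covariance relation depend continuously on \<open>f\<close>, so the
  set \<open>?R\<close> where they agree is closed. It contains the dense image of \<open>C\<close>,
  hence everything.\<close>

lemma weighted_flow_of_covariant_positive_flow:
  fixes K C :: "'a::{real_normed_algebra_1,banach} set"
    and j :: "'a \<Rightarrow> ('x::t2_space \<Rightarrow>\<^sub>C real)"
  assumes flow: "covariant_positive_flow K C E astar"
    and j: "phase_space K C j"
    and J: "phase_embedding K C j J"
    and \<alpha>: "phase_map C astar j \<alpha>"
    and fin: "\<And>\<eta>. \<bar>spectral_potential J E \<eta>\<bar> \<noteq> \<infinity>"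
  shows "weighted_flow K E J \<alpha>"
proof -
  interpret covariant_positive_flow K C E astar by (rule flow)
  have bl: "bounded_linear J" using J by (simp add: phase_embedding_def)
  have cont: "continuous_on UNIV \<alpha>" using \<alpha> by (simp add: phase_map_def)
  have blc: "bounded_linear (\<lambda>f. cfun_comp f \<alpha>)"
  proof (rule bounded_linear_intro[of _ 1])
    show "norm (cfun_comp f \<alpha>) \<le> norm f * 1" for f :: "'x \<Rightarrow>\<^sub>C real"
      using norm_bounded[of f] by (intro norm_bound) (simp add: cfun_comp_apply[OF cont])
  qed (auto intro!: bcontfun_eqI simp: cfun_comp_apply[OF cont])
  have "E * J f = J (cfun_comp f \<alpha>) * E" for f
  proof -
    let ?R = "{f. E * J f = J (cfun_comp f \<alpha>) * E}"
    have "continuous_on UNIV J" "continuous_on UNIV (\<lambda>f. J (cfun_comp f \<alpha>))"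
      using linear_continuous_on[OF bl] linear_continuous_on[OF bounded_linear_compose[OF bl blc]]
      by auto
    then have "closed ?R"
      by (intro closed_Collect_eq continuous_intros) auto
    moreover have "j ` C \<subseteq> ?R"
    proof safe
      fix a assume a: "a \<in> C"
      have "cfun_comp (j a) \<alpha> = j (astar a)"
        using \<alpha> a by (intro bcontfun_eqI) (simp add: cfun_comp_apply[OF cont] phase_map_def)
      then show "E * J (j a) = J (cfun_comp (j a) \<alpha>) * E"
        using J a astar_C[OF a] covariance[OF a] by (simp add: phase_embedding_def)
    qed
    ultimately have "closure (j ` C) \<subseteq> ?R" by (rule closure_minimal[rotated])
    then show ?thesis using j by (auto simp: phase_space_def)
  qed
  moreover have "J (const_bcontfun 1) = 1"
  proof -
    have "J (j 1) = 1" using J one_C by (simp add: phase_embedding_def)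
    moreover have "j 1 = const_bcontfun 1" using j by (simp add: phase_space_def)
    ultimately show ?thesis by simp
  qed
  ultimately show ?thesis
    using J bl cont fin E_K positive_algebra_axioms
    by (intro weighted_flow.intro weighted_flow_axioms.intro) (simp_all add: phase_embedding_def)
qed

theorem theorem7p3:
  fixes K C :: "'a::{real_normed_algebra_1,banach} set"
    and E :: 'a
    and astar :: "'a \<Rightarrow> 'a"
    and j :: "'a \<Rightarrow> ('x::t2_space \<Rightarrow>\<^sub>C real)"
    and J :: "('x \<Rightarrow>\<^sub>C real) \<Rightarrow> 'a"
    and alpha :: "'x \<Rightarrow> 'x"
    and L :: "('x \<Rightarrow>\<^sub>C real) set"
    and \<phi> :: "'x \<Rightarrow>\<^sub>C real"
    and \<nu> :: "'a \<Rightarrow>\<^sub>L real"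
    and P :: "nat \<Rightarrow> 'x measure"
  assumes "covariant_positive_flow K C E astar"
    and "phase_space K C j"
    and "phase_embedding K C j J"
    and "phase_map C astar j alpha"
    and "\<And>\<eta>. \<bar>spectral_potential J E \<eta>\<bar> \<noteq> \<infinity>"
    and "subspace L"
    and "\<phi> \<in> L"
    and "state K \<nu>"
    and "sensitive J E \<nu> \<phi>"
    and "\<And>n. blinfun_apply \<nu> (weighted J E \<phi> ^ n) > 0 \<Longrightarrow>
           riesz_probability (weighted_functional J E \<nu> \<phi> n) (P n)"
  shows "(\<forall>u\<in>dual_on L. \<forall>t1::real. ereal t1 > conditional_action J E L \<phi> u \<longrightarrow>
            (\<exists>V. openin (weak_star_on L) V \<and> u \<in> V \<and>
              (\<forall>\<^sub>F n in sequentially.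
                 measure (P n) {x. restrict (empirical alpha x n) L \<in> V} < exp (real n * t1))))
       \<and> (\<forall>\<psi>\<in>L. sensitive J E \<nu> \<psi> \<longrightarrow>
            (\<forall>U. \<forall>t2::real. openin (weak_star_on L) U \<longrightarrow> subgradients_on J E L \<psi> \<subseteq> U \<longrightarrow>
              ereal t2 < (INF u\<in>subgradients_on J E L \<psi>. conditional_action J E L \<phi> u) \<longrightarrow>
              (\<forall>\<^sub>F n in sequentially.
                 measure (P n) {x. restrict (empirical alpha x n) L \<in> U} > exp (real n * t2))))"
proof -
  interpret weighted_flow_state K E J alpha \<nu>
    using weighted_flow_of_covariant_positive_flow[OF assms(1-5)] assms(8)
    by (intro weighted_flow_state.intro weighted_flow_state_axioms.intro)
  have "represents (P n) \<phi> n" if "0 < blinfun_apply \<nu> (weighted J E \<phi> ^ n)" for n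
    using that assms(10)[OF that]
    by (auto simp: represents_def riesz_probability_def intro: finite_measureI)
  note * = assms(6,7,9) this
  show ?thesis
    by (intro conjI ballI allI impI eventually_measure_empirical_less[OF *]
        eventually_measure_empirical_greater[OF *])
qed

end
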